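(* Let $f\in L^1(\mathbb{T})$ be a probability density function and let $\{\ell_n\}_{n\in\mathbb{N}}$ be a decreasing sequence of positive numbers with $0<\ell_n<1$. Consider the condition $$(\ast)\qquad \limsup_{n\to\infty}\left(\frac{\ell_1+\dots+\ell_n}{\ln n}\right)\ \ge\ \frac{1}{m_f},$$ with the convention $1/m_f=\infty$ when $m_f=0$. (1) If $\mathbb{T}$ is $\mu_f$-Dvoretzky covered for $\{\ell_n\}$, then $(\ast)$ holds. If $m_f>0$ and the inequality in $(\ast)$ is strict, then $\mathbb{T}$ is $\mu_f$-Dvoretzky covered for $\{\ell_n\}$. (2) If $m_f>0$ and $\overline{\dim}_{\mathrm B}K_f<1$, then $\mathbb{T}$ is $\mu_f$-Dvoretzky covered for $\{\ell_n\}$ if and only if $(\ast)$ holds.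
   Context: $\mathbb{T}=\mathbb{R}/\mathbb{Z}$ is the circle with its usual metric and Lebesgue measure $|\cdot|$ (total mass $1$). A probability density function is a nonnegative $f\in L^1(\mathbb{T})$ with $\int_{\mathbb{T}}f=1$, and $\mu_f$ is the probability measure with $d\mu_f=f\,dx$. Given $\{\ell_n\}$, let $\{\omega_n\}$ be i.i.d. random variables on $\mathbb{T}$ with distribution $\mu_f$ and $I_n=(\omega_n-\ell_n/2,\ \omega_n+\ell_n/2)\subset\mathbb{T}$. The circle is $\mu_f$-Dvoretzky covered for $\{\ell_n\}$ if almost surely $\mathbb{T}=\limsup_{n\to\infty}I_n$, i.e. almost surely every point of $\mathbb{T}$ lies in infinitely many $I_n$. For a measurable set $J\subset\mathbb{T}$ with $|J|>0$, $\mathrm{ess\,inf}_J f=\sup\{a\in\mathbb{R}: f(x)\ge a \text{ for Lebesgue a.e. } x\in J\}$. Put $m_f=\mathrm{ess\,inf}_{\mathbb{T}}f$ and $K_f=\{x\in\mathbb{T}:\lim_{n\to\infty}\mathrm{ess\,inf}_{B(x,1/n)}f=m_f\}$, where $B(x,r)$ is the ball of radius $r$ centered at $x$ ($K_f$ is a non-empty compact set). $\overline{\dim}_{\mathrm B}$ is the upper box-counting dimension: $\overline{\dim}_{\mathrm B}Z=\limsup_{\delta\to0}\frac{\ln M(Z,\delta)}{-\ln\delta}$, with $M(Z,\delta)$ the least number of $\delta$-balls needed to cover $Z$. *)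

theory Defs
  imports "HOL-Probability.Probability"
begin

quotient_type circle = real / "\<lambda>x y :: real. x - y \<in> \<int>"
  morphisms rep_circle to_circle
proof (rule equivpI)
  show "reflp (\<lambda>x y :: real. x - y \<in> \<int>)"
    by (simp add: reflp_def)
  show "symp (\<lambda>x y :: real. x - y \<in> \<int>)"
    by (metis (no_types, lifting) Ints_minus minus_diff_eq sympI)
  show "transp (\<lambda>x y :: real. x - y \<in> \<int>)"
  proof (rule transpI)
    fix x y z :: real
    assume "x - y \<in> \<int>" "y - z \<in> \<int>"
    then have "(x - y) + (y - z) \<in> \<int>" by (rule Ints_add)
    then show "x - z \<in> \<int>" by simp
  qed
qed

lemma abs_diff_round_le:
  fixes u v :: real
  assumes "u - v \<in> \<int>"
  shows "\<bar>u - of_int (round u)\<bar> \<le> \<bar>v - of_int (round v)\<bar>"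
proof -
  obtain k where "u - v = of_int k"
    using assms by (auto elim: Ints_cases)
  then have "v - of_int (round v) = u - of_int (round v + k)"
    by (simp add: algebra_simps)
  then show ?thesis
    by (simp only: round_diff_minimal)
qed

instantiation circle :: metric_space
begin

text \<open>The distance of two classes is the distance of \<open>x - y\<close> to the nearest integer.\<close>

lift_definition dist_circle :: "circle \<Rightarrow> circle \<Rightarrow> real"
  is "\<lambda>x y. \<bar>(x - y) - of_int (round (x - y))\<bar>"
proof (rule antisym)
  fix x x' y y' :: real
  assume *: "x - x' \<in> \<int>" "y - y' \<in> \<int>"
  have **: "(x - y) - (x' - y') \<in> \<int>"
    using Ints_diff[OF *] by (simp add: algebra_simps)
  then have "(x' - y') - (x - y) \<in> \<int>"
    by (metis Ints_minus minus_diff_eq)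
  with ** show "\<bar>(x - y) - of_int (round (x - y))\<bar> \<le> \<bar>(x' - y') - of_int (round (x' - y'))\<bar>"
    and "\<bar>(x' - y') - of_int (round (x' - y'))\<bar> \<le> \<bar>(x - y) - of_int (round (x - y))\<bar>"
    by (blast intro: abs_diff_round_le)+
qed

definition uniformity_circle :: "(circle \<times> circle) filter"
  where "uniformity_circle = (INF e\<in>{0<..}. principal {(x, y). dist x y < e})"

definition open_circle :: "circle set \<Rightarrow> bool"
  where "open_circle U \<longleftrightarrow> (\<forall>x\<in>U. \<forall>\<^sub>F (x', y) in uniformity. x' = x \<longrightarrow> y \<in> U)"

instance
proof
  fix x y z :: circle
  show "(dist x y = 0) = (x = y)"
  proof transfer
    fix x y :: real
    show "(\<bar>(x - y) - of_int (round (x - y))\<bar> = 0) = (x - y \<in> \<int>)"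
      by (metis Ints_cases Ints_of_int abs_eq_0 eq_iff_diff_eq_0 round_of_int)
  qed
  show "dist x y \<le> dist x z + dist y z"
  proof transfer
    fix x y z :: real
    have "\<bar>(x - y) - of_int (round (x - y))\<bar>
        \<le> \<bar>(x - y) - of_int (round (x - z) - round (y - z))\<bar>"
      by (rule round_diff_minimal)
    also have "\<dots> \<le> \<bar>(x - z) - of_int (round (x - z))\<bar> + \<bar>(y - z) - of_int (round (y - z))\<bar>"
      by simp
    finally show "\<bar>(x - y) - of_int (round (x - y))\<bar>
        \<le> \<bar>(x - z) - of_int (round (x - z))\<bar> + \<bar>(y - z) - of_int (round (y - z))\<bar>" .
  qed
qed (rule uniformity_circle_def open_circle_def)+

end

lemma dist_to_circle_le: "dist (to_circle s) (to_circle t) \<le> \<bar>s - t\<bar>"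
  using round_diff_minimal[of "s - t" 0] by (simp add: dist_circle.abs_eq)

lemma continuous_to_circle: "continuous_on UNIV to_circle"
proof (clarsimp simp: continuous_on_iff)
  fix x e :: real
  assume "e > 0"
  then show "\<exists>d>0. \<forall>x'. dist x' x < d \<longrightarrow> dist (to_circle x') (to_circle x) < e"
    by (intro exI[of _ e]) (metis dist_to_circle_le dist_real_def le_less_trans)
qed

definition circle_lebesgue :: "circle measure"
  where "circle_lebesgue = distr (restrict_space lborel {0..<1}) borel to_circle"

lemma measurable_to_circle: "to_circle \<in> restrict_space lborel {0..<1} \<rightarrow>\<^sub>M borel"
proof -
  have "to_circle \<in> borel \<rightarrow>\<^sub>M borel"
    by (rule borel_measurable_continuous_onI[OF continuous_to_circle])
  then show ?thesis
    by (intro measurable_restrict_space1) simp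
qed

lemma prob_space_circle_lebesgue: "prob_space circle_lebesgue"
  unfolding circle_lebesgue_def
  by (rule prob_space.prob_space_distr[OF _ measurable_to_circle])
    (rule prob_spaceI, simp add: emeasure_restrict_space space_restrict_space)

text \<open>The open arc \<open>(c - l/2, c + l/2)\<close>.\<close>

definition arc_interval :: "circle \<Rightarrow> real \<Rightarrow> circle set"
  where "arc_interval c l = to_circle ` {rep_circle c - l / 2 <..< rep_circle c + l / 2}"

text \<open>Elements of \<open>L\<^sup>1\<close> are given by a Borel representative; nonnegativity is
  therefore required only almost everywhere.\<close>

definition prob_density :: "(circle \<Rightarrow> real) \<Rightarrow> bool"
  where "prob_density f \<longleftrightarrow> integrable circle_lebesgue f \<and>
    (AE x in circle_lebesgue. 0 \<le> f x) \<and> integral\<^sup>L circle_lebesgue f = 1"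

definition density_measure :: "(circle \<Rightarrow> real) \<Rightarrow> circle measure"
  where "density_measure f = density circle_lebesgue (\<lambda>x. ennreal (f x))"

text \<open>The supremum is taken in the reals: for a probability density \<open>f\<close> and \<open>J\<close> of positive
  measure the set contains \<open>0\<close> and is bounded above.\<close>

definition ess_inf :: "circle set \<Rightarrow> (circle \<Rightarrow> real) \<Rightarrow> real"
  where "ess_inf J f = Sup {a. AE x in circle_lebesgue. x \<in> J \<longrightarrow> a \<le> f x}"

definition min_density :: "(circle \<Rightarrow> real) \<Rightarrow> real"
  where "min_density f = ess_inf UNIV f"

definition min_set :: "(circle \<Rightarrow> real) \<Rightarrow> circle set"
  where "min_set f = {x. (\<lambda>n. ess_inf (ball x (1 / real n)) f) \<longlonglongrightarrow> min_density f}"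

text \<open>Meaningful for totally bounded \<open>Z\<close>; this includes all subsets of the circle.\<close>

definition covering_number :: "'a::metric_space set \<Rightarrow> real \<Rightarrow> nat"
  where "covering_number Z \<delta> =
    (LEAST n. \<exists>C. finite C \<and> card C = n \<and> Z \<subseteq> (\<Union>c\<in>C. ball c \<delta>))"

definition upper_box_dim :: "'a::metric_space set \<Rightarrow> ereal"
  where "upper_box_dim Z =
    Limsup (at_right 0) (\<lambda>\<delta>. ereal (ln (real (covering_number Z \<delta>)) / - ln \<delta>))"

text \<open>Here \<open>limsup\<close> is the limit superior in the complete lattice of subsets of the circle,
  i.e. the set of points lying in infinitely many arcs.\<close>

definition dvoretzky_covered ::
    "'a measure \<Rightarrow> (nat \<Rightarrow> 'a \<Rightarrow> circle) \<Rightarrow> (nat \<Rightarrow> real) \<Rightarrow> bool"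
  where "dvoretzky_covered M \<omega> l \<longleftrightarrow>
    (AE a in M. limsup (\<lambda>n. arc_interval (\<omega> n a) (l n)) = UNIV)"

definition log_average_limsup :: "(nat \<Rightarrow> real) \<Rightarrow> ereal"
  where "log_average_limsup l = limsup (\<lambda>n. ereal ((\<Sum>k=1..n. l k) / ln (real n)))"

text \<open>The convention for \<open>1 / m\<close> with \<open>m = 0\<close> is that of division in \<^typ>\<open>ereal\<close>:\<close>

lemma one_divide_ereal_zero: "1 / ereal 0 = \<infinity>"
  by (simp add: zero_ereal_def[symmetric] divide_ereal_def)

end

theory Submission
  imports Defs "HOL-Real_Asymp.Real_Asymp"
begin

text \<open>
  Sufficiency is a union bound along the \<open>n\<close> for which \<open>l 1 + \<dots> + l n > p ln n\<close>. If every point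
  of \<open>Z\<close> sees density at least \<open>c\<close>, a fixed point misses the first \<open>n\<close> arcs, shrunk by \<open>O(1 / n)\<close>,
  with probability at most a constant times \<open>n powr (- c p)\<close>; if \<open>n powr s\<close> balls of radius \<open>O(1 / n)\<close>
  cover \<open>Z\<close>, then \<open>s < c p\<close> suffices. The whole circle has \<open>s = 1\<close>. In the critical case the
  minimal set tolerates \<open>c p\<close> slightly below \<open>1\<close> since \<open>s < 1\<close> there, and its complement is a
  countable union of balls on which the density exceeds some \<open>c > m\<close>.

  Necessity is a second moment argument. For \<open>c > m\<close>, Lebesgue differentiation gives a closed set
  \<open>E\<close> of positive measure all of whose small balls have mass at most \<open>c\<close> times their length. Let
  \<open>X N\<close> be the integral over \<open>E\<close> of the indicator of being missed by the arcs \<open>n0..N\<close>, normalised to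
  have mean one at each point. If the sums \<open>l 1 + \<dots> + l n\<close> are at most \<open>L ln n\<close> with \<open>c L < 1\<close>,
  then the second moment of \<open>X N\<close> stays bounded, so \<open>X N > 0\<close> with probability bounded below, and compactness
  of \<open>E\<close> yields an uncovered point.
\<close>

subsection \<open>Geometry and measure of the circle\<close>

lemma to_circle_surj: obtains t where "t \<in> {0..<1}" "x = to_circle t"
proof -
  obtain u where u: "x = to_circle u"
    by (metis Quotient3_circle Quotient3_def)
  have "x = to_circle (frac u)"
    unfolding u by (simp add: circle.abs_eq_iff frac_def)
  moreover have "frac u \<in> {0..<1}"
    by (simp add: frac_lt_1)
  ultimately show ?thesis using that by blast
qed

lemma to_circle_add_of_int [simp]: "to_circle (t + of_int k) = to_circle t"
  by (simp add: circle.abs_eq_iff)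

lemma compact_UNIV_circle: "compact (UNIV :: circle set)"
proof -
  have "UNIV = to_circle ` {0..1}"
  proof -
    have "x \<in> to_circle ` {0..1}" for x
    proof -
      obtain t where "t \<in> {0..<1}" "x = to_circle t" by (rule to_circle_surj)
      then show ?thesis by (intro image_eqI[of _ _ t]) auto
    qed
    then show ?thesis by blast
  qed
  moreover have "compact (to_circle ` {0..1})"
    by (intro compact_continuous_image continuous_on_subset[OF continuous_to_circle]) auto
  ultimately show ?thesis by simp
qed

text \<open>Second countability makes \<open>dist\<close> jointly measurable on products and permits
  a Lindelof argument. The basis consists of the balls of radius \<open>1 / Suc n\<close> around
  images of rationals.\<close>

instance circle :: second_countable_topology
proof
  define B where "B = (\<lambda>(q, n). ball (to_circle q) (1 / real (Suc n))) ` (\<rat> \<times> (UNIV :: nat set))"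
  have "topological_basis B"
  proof (rule topological_basisI)
    show "open b" if "b \<in> B" for b
      using that by (auto simp: B_def)
    fix U and x :: circle
    assume U: "open U" "x \<in> U"
    then obtain e where e: "e > 0" "ball x e \<subseteq> U"
      using open_contains_ball by blast
    obtain n where n: "1 / real (Suc n) < e / 2"
      using nat_approx_posE[of "e / 2"] e by auto
    obtain t where t: "x = to_circle t" by (rule to_circle_surj)
    obtain q where q: "q \<in> \<rat>" "t < q" "q < t + 1 / real (Suc n)"
      using Rats_dense_in_real[of t "t + 1 / real (Suc n)"] by auto
    have d: "dist (to_circle q) x < 1 / real (Suc n)"
      using dist_to_circle_le[of q t] q unfolding t by auto
    have "ball (to_circle q) (1 / real (Suc n)) \<subseteq> ball x e"
    proof
      fix y assume "y \<in> ball (to_circle q) (1 / real (Suc n))"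
      then show "y \<in> ball x e"
        using d n dist_triangle3[of x y "to_circle q"] by (auto simp del: of_nat_Suc)
    qed
    then show "\<exists>b\<in>B. x \<in> b \<and> b \<subseteq> U"
      using d q e by (intro bexI[of _ "ball (to_circle q) (1 / real (Suc n))"])
        (auto simp: B_def)
  qed
  moreover have "countable B"
    unfolding B_def by (intro countable_image countable_SIGMA countable_rat) auto
  ultimately show "\<exists>B :: circle set set. countable B \<and> open = generate_topology B"
    using topological_basis_imp_subbasis by blast
qed

text \<open>Since \<open>round\<close> picks a nearest integer, any integer within \<open>r\<close>
  forces the distance below \<open>r\<close>. The existential form spares later arguments any
  reasoning about \<open>round\<close>.\<close>

lemma dist_to_circle_less_iff:
  "dist (to_circle s) (to_circle t) < r \<longleftrightarrow> (\<exists>k. \<bar>s - t - of_int k\<bar> < r)"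
  unfolding dist_circle.abs_eq
proof
  assume "\<exists>k. \<bar>s - t - of_int k\<bar> < r"
  then show "\<bar>s - t - of_int (round (s - t))\<bar> < r"
    using round_diff_minimal[of "s - t"] by (auto intro: le_less_trans)
qed blast

text \<open>Turns arcs into metric balls, so that covering can be argued by the triangle inequality.
  No bound on \<open>l\<close> is needed: an arc that wraps around and an empty arc both agree with
  the ball.\<close>

lemma arc_interval_eq_ball: "arc_interval c l = ball c (l / 2)"
proof -
  define u where "u = rep_circle c"
  have c: "c = to_circle u"
    by (metis u_def Quotient3_abs_rep Quotient3_circle)
  have "x \<in> to_circle ` {u - l / 2<..<u + l / 2} \<longleftrightarrow> x \<in> ball c (l / 2)" for x
  proof -
    obtain t where t: "x = to_circle t" by (rule to_circle_surj)
    have "x \<in> ball c (l / 2) \<longleftrightarrow> (\<exists>k. \<bar>u - t - of_int k\<bar> < l / 2)"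
      unfolding c t mem_ball by (rule dist_to_circle_less_iff)
    also have "\<dots> \<longleftrightarrow> x \<in> to_circle ` {u - l / 2<..<u + l / 2}"
    proof
      assume "\<exists>k. \<bar>u - t - of_int k\<bar> < l / 2"
      then obtain k where k: "\<bar>u - t - of_int k\<bar> < l / 2" ..
      have "x = to_circle (t + of_int k)" by (simp add: t)
      then show "x \<in> to_circle ` {u - l / 2<..<u + l / 2}"
        using k by (intro image_eqI[of _ _ "t + of_int k"])
          (simp_all only: greaterThanLessThan_iff abs_less_iff, linarith+)
    next
      assume "x \<in> to_circle ` {u - l / 2<..<u + l / 2}"
      then obtain s where s: "x = to_circle s" "\<bar>u - s\<bar> < l / 2"
        by (auto simp: abs_less_iff simp del: less_divide_eq_numeral1)
      then obtain k where k: "s - t = of_int k"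
        using t by (metis Ints_cases circle.abs_eq_iff)
      then have "u - t - of_int k = u - s" by linarith
      with s(2) show "\<exists>k. \<bar>u - t - of_int k\<bar> < l / 2"
        by metis
    qed
    finally show ?thesis by simp
  qed
  then show ?thesis unfolding arc_interval_def u_def by (rule set_eqI)
qed

section \<open>Lebesgue measure of balls, and finite nets\<close>

lemma sets_circle_lebesgue [simp, measurable_cong]: "sets circle_lebesgue = sets borel"
  and space_circle_lebesgue [simp]: "space circle_lebesgue = UNIV"
  by (simp_all add: circle_lebesgue_def)

lemma nn_integral_circle_lebesgue:
  assumes [measurable]: "g \<in> borel_measurable borel"
  shows "(\<integral>\<^sup>+x. g x \<partial>circle_lebesgue) = (\<integral>\<^sup>+t. g (to_circle t) * indicator {0..<1} t \<partial>lborel)"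
  unfolding circle_lebesgue_def using measurable_to_circle
  by (simp add: nn_integral_distr nn_integral_restrict_space)

lemma borel_measurable_to_circle [measurable]: "to_circle \<in> borel \<rightarrow>\<^sub>M borel"
  by (rule borel_measurable_continuous_onI[OF continuous_to_circle])

lemma emeasure_circle_lebesgue:
  assumes "A \<in> sets borel"
  shows "emeasure circle_lebesgue A = emeasure lborel (to_circle -` A \<inter> {0..<1})"
  unfolding circle_lebesgue_def using measurable_to_circle assms
  by (subst emeasure_distr)
    (auto simp: space_restrict_space emeasure_restrict_space)

text \<open>With both representatives in [0,1) and \<open>r \<le> 1\<close>, only the shifts
  \<open>k\<close> = -1, 0, 1 can bring them within \<open>r\<close>. The two half-lines are the
  pieces of the ball that wrap past 1 and past 0.\<close>

lemma vimage_ball_to_circle: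
  assumes "t \<in> {0..<1}" "r \<le> 1"
  shows "to_circle -` ball (to_circle t) r \<inter> {0..<1} =
    {0..<1} \<inter> ({t - r<..<t + r} \<union> {..<t + r - 1} \<union> {t - r + 1<..})"
proof -
  have "(\<exists>k. \<bar>t - s - of_int k\<bar> < r) \<longleftrightarrow> (\<bar>t - s\<bar> < r \<or> s < t + r - 1 \<or> s > t - r + 1)"
    if "s \<in> {0..<1}" for s
  proof
    assume "\<exists>k. \<bar>t - s - of_int k\<bar> < r"
    then obtain k where k: "\<bar>t - s - of_int k\<bar> < r" ..
    have "\<bar>real_of_int k\<bar> < 2" using k assms that by auto
    then have "k = 0 \<or> k = 1 \<or> k = -1" by linarith
    then show "\<bar>t - s\<bar> < r \<or> s < t + r - 1 \<or> s > t - r + 1" using k by auto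
  next
    assume "\<bar>t - s\<bar> < r \<or> s < t + r - 1 \<or> s > t - r + 1"
    moreover have "\<bar>t - s - of_int 1\<bar> < r" if "s < t + r - 1"
      using that assms \<open>s \<in> {0..<1}\<close> by auto
    moreover have "\<bar>t - s - of_int (- 1)\<bar> < r" if "s > t - r + 1"
      using that assms \<open>s \<in> {0..<1}\<close> by auto
    moreover have "\<bar>t - s - of_int 0\<bar> < r" if "\<bar>t - s\<bar> < r"
      using that by simp
    ultimately show "\<exists>k. \<bar>t - s - of_int k\<bar> < r"
      by blast
  qed
  then show ?thesis
    by (auto simp: dist_to_circle_less_iff abs_less_iff)
qed

lemma emeasure_circle_lebesgue_ball:
  assumes "0 \<le> r" "r \<le> 1 / 2"
  shows "emeasure circle_lebesgue (ball x r) = ennreal (2 * r)"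
proof -
  obtain t where t: "t \<in> {0..<1}" "x = to_circle t" by (rule to_circle_surj)
  have eq: "emeasure circle_lebesgue (ball x r) = emeasure lborel
    ({0..<1} \<inter> ({t - r<..<t + r} \<union> {..<t + r - 1} \<union> {t - r + 1<..}))"
    using assms t by (simp add: emeasure_circle_lebesgue vimage_ball_to_circle)
  \<comment> \<open>The ball does not wrap, wraps past 0, or wraps past 1. In the wrapping cases
    \<open>r \<le> 1 / 2\<close> makes the two pieces disjoint.\<close>
  consider "r \<le> t" "t + r \<le> 1" | "t < r" | "1 < t + r"
    by linarith
  then show ?thesis
  proof cases
    case 1
    then have "{0..<1} \<inter> ({t - r<..<t + r} \<union> {..<t + r - 1} \<union> {t - r + 1<..}) = {t - r<..<t + r}"
      using assms t by auto
    then show ?thesis using assms by (simp add: eq)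
  next
    case 2
    then have "{0..<1} \<inter> ({t - r<..<t + r} \<union> {..<t + r - 1} \<union> {t - r + 1<..}) = {0..<t + r} \<union> {t - r + 1<..<1}"
      using assms t by auto
    moreover have "emeasure lborel ({0..<t + r} \<union> {t - r + 1<..<1}) = ennreal (2 * r)"
      using assms t 2
      by (subst plus_emeasure[symmetric]) (auto simp: ennreal_plus[symmetric] simp del: ennreal_plus)
    ultimately show ?thesis by (simp only: eq)
  next
    case 3
    then have "{0..<1} \<inter> ({t - r<..<t + r} \<union> {..<t + r - 1} \<union> {t - r + 1<..}) = {0..<t + r - 1} \<union> {t - r<..<1}"
      using assms t by auto
    moreover have "emeasure lborel ({0..<t + r - 1} \<union> {t - r<..<1}) = ennreal (2 * r)"
      using assms t 3
      by (subst plus_emeasure[symmetric]) (auto simp: ennreal_plus[symmetric] simp del: ennreal_plus)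
    ultimately show ?thesis by (simp only: eq)
  qed
qed

lemma emeasure_circle_lebesgue_ball_le:
  assumes "0 \<le> r"
  shows "emeasure circle_lebesgue (ball x r) \<le> ennreal (2 * r)"
proof (cases "r \<le> 1 / 2")
  case True
  then show ?thesis using assms by (simp add: emeasure_circle_lebesgue_ball)
next
  case False
  interpret prob_space circle_lebesgue by (rule prob_space_circle_lebesgue)
  have "emeasure circle_lebesgue (ball x r) \<le> 1" by (rule emeasure_le_1)
  also have "\<dots> \<le> ennreal (2 * r)" using False by (simp add: ennreal_1[symmetric] del: ennreal_1)
  finally show ?thesis .
qed

text \<open>The points \<open>j / n\<close> serve as centres: a representative \<open>t\<close> is
  within \<open>1 / n\<close> of the one with \<open>j\<close> the floor of \<open>t * n\<close>.
  Asking only for \<open>card C \<le> n\<close> avoids showing that they are distinct.\<close>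

lemma circle_finite_net:
  assumes "n > 0"
  obtains C :: "circle set" where "finite C" "card C \<le> n" "(\<Union>c\<in>C. ball c (1 / real n)) = UNIV"
proof
  define C where "C = (\<lambda>j. to_circle (real j / real n)) ` {..<n}"
  show "finite C" "card C \<le> n"
    using card_image_le[of "{..<n}" "\<lambda>j. to_circle (real j / real n)"] by (auto simp: C_def)
  have "\<exists>c\<in>C. x \<in> ball c (1 / real n)" for x
  proof -
    obtain t where t: "t \<in> {0..<1}" "x = to_circle t" by (rule to_circle_surj)
    define j where "j = nat \<lfloor>t * real n\<rfloor>"
    have nn: "0 \<le> t * real n" "t * real n < real n" using t assms by auto
    then have j: "real j \<le> t * real n" "t * real n < real j + 1"
      by (simp_all add: j_def)
    then have "j < n" using nn by linarith
    moreover have "\<bar>real j / real n - t\<bar> < 1 / real n"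
    proof -
      have "real j / real n - t = (real j - t * real n) / real n"
        using assms by (simp add: field_simps)
      then have "\<bar>real j / real n - t\<bar> = \<bar>real j - t * real n\<bar> / real n"
        by simp
      also have "\<dots> < 1 / real n"
        using j assms by (intro divide_strict_right_mono) auto
      finally show ?thesis .
    qed
    then have "x \<in> ball (to_circle (real j / real n)) (1 / real n)"
      using dist_to_circle_le[of "real j / real n" t] unfolding t by simp
    ultimately show ?thesis by (auto simp: C_def)
  qed
  then show "(\<Union>c\<in>C. ball c (1 / real n)) = UNIV" by blast
qed

subsection \<open>Union bound for covering\<close>

text \<open>The bad set need not be measurable itself: it lies in the intersection of countably many
  events of probability tending to 0, and that intersection is a null event.\<close>

lemma (in prob_space) AE_if_bad_set_small:
  assumes "\<And>e. e > 0 \<Longrightarrow> \<exists>B\<in>events. {a \<in> space M. \<not> P a} \<subseteq> B \<and> prob B < e"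
  shows "AE a in M. P a"
proof -
  have "\<forall>j. \<exists>B\<in>events. {a \<in> space M. \<not> P a} \<subseteq> B \<and> prob B < 1 / real (Suc j)"
    using assms by simp
  then obtain B where B: "\<And>j. B j \<in> events" "\<And>j. {a \<in> space M. \<not> P a} \<subseteq> B j"
    "\<And>j. prob (B j) < 1 / real (Suc j)"
    by metis
  define N where "N = (\<Inter>j. B j)"
  have N: "N \<in> events" unfolding N_def using B(1) by auto
  have le: "prob N < 1 / real (Suc j)" for j
  proof -
    have "prob N \<le> prob (B j)"
      using B(1) by (intro finite_measure_mono) (auto simp: N_def)
    also note B(3)
    finally show ?thesis .
  qed
  have "prob N = 0"
  proof (rule ccontr)
    assume "prob N \<noteq> 0"
    then have "prob N > 0" by (simp add: zero_less_measure_iff)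
    then obtain j where "1 / real (Suc j) < prob N" by (rule nat_approx_posE)
    with le[of j] show False by linarith
  qed
  then have "N \<in> null_sets M"
    using N by (simp add: emeasure_eq_measure null_setsI)
  moreover have "{a \<in> space M. \<not> P a} \<subseteq> N" using B(2) by (auto simp: N_def)
  ultimately show ?thesis by (rule AE_I')
qed

section \<open>Partial sums that are large infinitely often\<close>

lemma less_log_average_limsup:
  assumes "ereal q < log_average_limsup l"
  shows "\<exists>\<^sub>F n in sequentially. q * ln (real n) < (\<Sum>k=1..n. l k)"
proof -
  have "\<exists>\<^sub>F n in sequentially. q < (\<Sum>k=1..n. l k) / ln (real n)"
  proof (rule ccontr)
    assume "\<not> ?thesis"
    then have "\<forall>\<^sub>F n in sequentially. ereal ((\<Sum>k=1..n. l k) / ln (real n)) \<le> ereal q"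
      by (simp add: not_frequently not_less)
    then have "log_average_limsup l \<le> ereal q"
      unfolding log_average_limsup_def by (rule Limsup_bounded)
    with assms show False by simp
  qed
  \<comment> \<open>From \<open>n = 2\<close> on the logarithm is positive, so the quotient can be
    cleared.\<close>
  then have "\<exists>\<^sub>F n in sequentially. n \<ge> 2 \<and> q < (\<Sum>k=1..n. l k) / ln (real n)"
    using eventually_ge_at_top by (rule frequently_eventually_conj)
  then show ?thesis
    by (rule frequently_elim1) (auto simp: pos_less_divide_eq)
qed

text \<open>If \<open>l\<close> drops below \<open>r\<close>, deleting initial terms and truncating
  change the sum by at most a constant, which the gap \<open>(q - p) * ln n\<close> absorbs.
  Otherwise monotonicity keeps every term at least \<open>r\<close>, and the truncated sum grows
  linearly.\<close>

lemma frequently_less_truncated_sum: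
  fixes l :: "nat \<Rightarrow> real"
  assumes anti: "antimono_on {1..} l" and pos: "\<And>n. n \<ge> 1 \<Longrightarrow> 0 < l n"
    and "r > 0" and p: "ereal p < log_average_limsup l" and "n0 \<ge> 1"
  shows "\<exists>\<^sub>F n in sequentially. p * ln (real n) < (\<Sum>k=n0..n. min (l k) r)"
proof (cases "\<exists>N. \<forall>k\<ge>N. l k < r")
  case True
  then obtain N where N: "\<And>k. k \<ge> N \<Longrightarrow> l k < r" by blast
  obtain q where q: "p < q" "ereal q < log_average_limsup l"
    using ereal_dense2[OF p] by auto
  define L where "L = max n0 N"
  have L: "1 \<le> L" "n0 \<le> L" "N \<le> L" using \<open>n0 \<ge> 1\<close> by (auto simp: L_def)
  define K where "K = (\<Sum>k\<in>{1..<L}. l k)"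
  have "\<forall>\<^sub>F n in sequentially. K < (q - p) * ln (real n)"
    using q by real_asymp
  then have "\<forall>\<^sub>F n in sequentially. K < (q - p) * ln (real n) \<and> L \<le> n"
    using eventually_ge_at_top by (rule eventually_conj)
  from frequently_eventually_conj[OF less_log_average_limsup[OF q(2)] this]
  show ?thesis
  proof (rule frequently_elim1, elim conjE)
    fix n assume n: "q * ln (real n) < sum l {1..n}" "K < (q - p) * ln (real n)" "L \<le> n"
    have "{1..n} = {1..<L} \<union> {L..n}" using L n(3) by auto
    then have "sum l {1..n} = K + sum l {L..n}"
      by (simp add: K_def) (subst sum.union_disjoint, auto)
    also have "sum l {L..n} = (\<Sum>k=L..n. min (l k) r)"
      using N L by (intro sum.cong) (auto simp: min_def less_imp_le)
    also have "\<dots> \<le> (\<Sum>k=n0..n. min (l k) r)"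
      using L pos \<open>r > 0\<close> \<open>n0 \<ge> 1\<close> by (intro sum_mono2) (auto simp: less_imp_le)
    finally have "sum l {1..n} \<le> K + (\<Sum>k=n0..n. min (l k) r)" by simp
    then show "p * ln (real n) < (\<Sum>k=n0..n. min (l k) r)"
      using n by (simp add: algebra_simps)
  qed
next
  case False
  have ge: "l k \<ge> r" if "k \<ge> 1" for k
  proof -
    obtain k' where "k' \<ge> k" "r \<le> l k'"
      using False by (auto simp: not_less)
    moreover from this have "l k' \<le> l k"
      using that anti by (auto simp: monotone_on_def)
    ultimately show ?thesis by linarith
  qed
  have sum: "(\<Sum>k=n0..n. min (l k) r) = (\<Sum>k=n0..n. r)" for n
    using \<open>n0 \<ge> 1\<close> ge by (intro sum.cong) (auto intro!: min_absorb2)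
  have "\<forall>\<^sub>F n in sequentially. p * ln (real n) < r * (real n - real n0)"
    using \<open>r > 0\<close> by real_asymp
  then have "\<forall>\<^sub>F n in sequentially. p * ln (real n) < r * (real n - real n0) \<and> n0 \<le> n"
    using eventually_ge_at_top by (rule eventually_conj)
  then have "\<forall>\<^sub>F n in sequentially. p * ln (real n) < (\<Sum>k=n0..n. min (l k) r)"
    unfolding sum using \<open>r > 0\<close>
    by (elim eventually_mono) (auto simp: of_nat_diff algebra_simps)
  then show ?thesis
    by (rule eventually_frequently[rotated]) simp
qed

lemma mem_limsup_sets: "x \<in> limsup A \<longleftrightarrow> (\<forall>n. \<exists>k\<ge>n. x \<in> A k)" for A :: "nat \<Rightarrow> 'b set"
  by (auto simp: limsup_INF_SUP)

text \<open>The common law \<open>\<mu>\<close> is left arbitrary: both the union bound and the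
  second moment argument use it only through the masses of balls and of their intersections.\<close>

locale random_centers = prob_space M for M :: "'a measure" +
  fixes \<omega> :: "nat \<Rightarrow> 'a \<Rightarrow> circle" and \<mu> :: "circle measure"
  assumes indep: "indep_vars (\<lambda>_. borel) \<omega> {1..}"
    and distr_eq: "\<And>n. n \<ge> 1 \<Longrightarrow> distr M borel (\<omega> n) = \<mu>"
begin

lemma center_measurable [measurable]: "n \<ge> 1 \<Longrightarrow> \<omega> n \<in> M \<rightarrow>\<^sub>M borel"
  using indep by (auto simp: indep_vars_def)

lemma sets_distribution [simp, measurable_cong]: "sets \<mu> = sets borel"
  by (subst distr_eq[of 1, symmetric]) auto

lemma prob_space_distribution: "prob_space \<mu>"
  by (subst distr_eq[of 1, symmetric]) (auto intro: prob_space_distr)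

lemma measure_distribution:
  assumes "n \<ge> 1" "A \<in> sets borel"
  shows "measure \<mu> A = prob {a \<in> space M. \<omega> n a \<in> A}"
  using assms center_measurable[of n]
  by (subst distr_eq[OF assms(1), symmetric], subst measure_distr)
     (auto intro!: arg_cong[of _ _ prob])

lemma prob_avoid_all:
  assumes "finite I" "I \<subseteq> {1..}" and A: "\<And>n. n \<in> I \<Longrightarrow> A n \<in> sets borel"
  shows "prob {a \<in> space M. \<forall>n\<in>I. \<omega> n a \<notin> A n} = (\<Prod>n\<in>I. 1 - measure \<mu> (A n))"
\<comment> \<open>The empty index set is separate because the intersection used below would then be
  \<open>UNIV\<close> rather than \<open>space M\<close>.\<close>
proof (cases "I = {}")
  case True
  then show ?thesis by (simp add: prob_space)
next
  case False
  have "{a \<in> space M. \<forall>n\<in>I. \<omega> n a \<notin> A n} = (\<Inter>n\<in>I. \<omega> n -` (- A n) \<inter> space M)"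
    using False by auto
  also have "prob \<dots> = (\<Prod>n\<in>I. prob (\<omega> n -` (- A n) \<inter> space M))"
    using assms False by (intro indep_varsD[OF indep]) auto
  also have "\<dots> = (\<Prod>n\<in>I. 1 - measure \<mu> (A n))"
  proof (intro prod.cong refl)
    fix n assume n: "n \<in> I"
    interpret \<mu>: prob_space \<mu> by (rule prob_space_distribution)
    have "space \<mu> = UNIV" using sets_eq_imp_space_eq[OF sets_distribution] by simp
    moreover have "prob (\<omega> n -` (- A n) \<inter> space M) = measure \<mu> (- A n)"
      using n assms by (subst measure_distribution[of n]) (auto intro!: arg_cong[of _ _ prob])
    ultimately show "prob (\<omega> n -` (- A n) \<inter> space M) = 1 - measure \<mu> (A n)"
      using \<mu>.prob_compl[of "A n"] A[OF n] by (simp add: Compl_eq_Diff_UNIV)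
  qed
  finally show ?thesis .
qed

text \<open>If a point of \<open>Z\<close> is missed by the arcs \<open>n0..n\<close>, a net centre
  within \<open>2 / n\<close> of it is missed by the arcs with radii shrunk by \<open>2 / n\<close>.
  One centre is missed with probability at most \<open>exp (4 * c) * n powr (- c * p)\<close>, and
  the at most \<open>n powr s\<close> centres together contribute a bound that tends to 0. The net
  exists for all large \<open>n\<close>, so \<open>n\<close> may be taken among those given by
  \<open>freq\<close>.\<close>

lemma AE_subset_union_arcs:
  assumes c: "0 \<le> c" "s < c * p" and n0: "n0 \<ge> 1"
    and mass: "\<And>k z r. \<lbrakk>k \<ge> n0; z \<in> Z; 0 \<le> r; r \<le> l k / 2\<rbrakk> \<Longrightarrow> 2 * c * r \<le> measure \<mu> (ball z r)"
    and net: "\<forall>\<^sub>F n in sequentially. \<exists>C. finite C \<and> C \<subseteq> Z \<and> real (card C) \<le> real n powr s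
      \<and> Z \<subseteq> (\<Union>z\<in>C. ball z (2 / real n))"
    and freq: "\<exists>\<^sub>F n in sequentially. p * ln (real n) < (\<Sum>k=n0..n. l k)"
  shows "AE a in M. Z \<subseteq> (\<Union>k\<in>{n0..}. ball (\<omega> k a) (l k / 2))"
proof (rule AE_if_bad_set_small)
  fix e :: real assume "e > 0"
  interpret \<mu>: prob_space \<mu> by (rule prob_space_distribution)
  have "\<forall>\<^sub>F n in sequentially. exp (4 * c) * real n powr (s - c * p) < e"
    using c \<open>e > 0\<close> by real_asymp
  then have "\<forall>\<^sub>F n in sequentially. exp (4 * c) * real n powr (s - c * p) < e
      \<and> (\<exists>C. finite C \<and> C \<subseteq> Z \<and> real (card C) \<le> real n powr s
      \<and> Z \<subseteq> (\<Union>z\<in>C. ball z (2 / real n))) \<and> n \<ge> n0"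
    using net by (intro eventually_conj eventually_ge_at_top)
  from frequently_ex[OF frequently_eventually_conj[OF freq this]]
  obtain n C where n: "p * ln (real n) < (\<Sum>k=n0..n. l k)" "n \<ge> n0"
    "exp (4 * c) * real n powr (s - c * p) < e"
    and C: "finite C" "C \<subseteq> Z" "real (card C) \<le> real n powr s"
    "Z \<subseteq> (\<Union>z\<in>C. ball z (2 / real n))"
    by blast
  have "n \<ge> 1" using n n0 by linarith
  define B where "B z = {a \<in> space M. \<forall>k\<in>{n0..n}. \<omega> k a \<notin> ball z (l k / 2 - 2 / real n)}" for z
  have B: "B z \<in> events" for z
  proof -
    have [measurable]: "\<omega> k \<in> M \<rightarrow>\<^sub>M borel" if "k \<in> {n0..n}" for k
      using that n0 by (intro center_measurable) auto
    show ?thesis unfolding B_def mem_ball by measurable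
  qed
  have prob_B: "prob (B z) \<le> exp (4 * c) * real n powr (- c * p)" if "z \<in> C" for z
  proof -
    have le: "1 - measure \<mu> (ball z (l k / 2 - 2 / real n)) \<le> exp (- c * (l k - 4 / real n))"
      if "k \<in> {n0..n}" for k
    proof -
      have "c * (l k - 4 / real n) \<le> measure \<mu> (ball z (l k / 2 - 2 / real n))"
      \<comment> \<open>For a negative shrunk radius \<open>mass\<close> says nothing, but the
        claimed lower bound is then at most 0.\<close>
      proof (cases "0 \<le> l k / 2 - 2 / real n")
        case True
        then have "2 * c * (l k / 2 - 2 / real n) \<le> measure \<mu> (ball z (l k / 2 - 2 / real n))"
          using that C \<open>z \<in> C\<close> by (intro mass) auto
        then show ?thesis by (simp add: algebra_simps)
      next
        case False
        then have "c * (l k - 4 / real n) \<le> 0"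
          using c by (intro mult_nonneg_nonpos) auto
        then show ?thesis using measure_nonneg order_trans by blast
      qed
      then have "1 - measure \<mu> (ball z (l k / 2 - 2 / real n)) \<le> 1 + (- c * (l k - 4 / real n))"
        by simp
      also have "\<dots> \<le> exp (- c * (l k - 4 / real n))" by (rule exp_ge_add_one_self)
      finally show ?thesis .
    qed
    have "prob (B z) = (\<Prod>k\<in>{n0..n}. 1 - measure \<mu> (ball z (l k / 2 - 2 / real n)))"
      unfolding B_def using n0 by (intro prob_avoid_all) auto
    also have "\<dots> \<le> (\<Prod>k\<in>{n0..n}. exp (- c * (l k - 4 / real n)))"
      using le by (intro prod_mono) auto
    also have "\<dots> = exp (- c * (\<Sum>k=n0..n. l k) + c * ((real n + 1 - real n0) * (4 / real n)))"
      using n(2) by (simp add: exp_sum[symmetric] sum_negf sum_distrib_left[symmetric]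
          sum_subtractf right_diff_distrib of_nat_diff) (use \<open>n \<ge> 1\<close> in \<open>simp add: field_simps\<close>)
    \<comment> \<open>Shrinking costs \<open>4 / n\<close> in each of at most \<open>n\<close>
      factors, hence only a constant in total.\<close>
    also have "\<dots> \<le> exp (- c * (p * ln (real n)) + c * 4)"
    proof -
      have "(real n + 1 - real n0) * (4 / real n) \<le> real n * (4 / real n)"
        using n0 by (intro mult_right_mono) auto
      also have "\<dots> = 4" using \<open>n \<ge> 1\<close> by simp
      finally have "c * ((real n + 1 - real n0) * (4 / real n)) \<le> c * 4"
        using c by (intro mult_left_mono) auto
      moreover have "c * (p * ln (real n)) \<le> c * (\<Sum>k=n0..n. l k)"
        using c n(1) by (intro mult_left_mono) auto
      ultimately show ?thesis by simp
    qed
    also have "\<dots> = exp (4 * c) * real n powr (- c * p)"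
      using \<open>n \<ge> 1\<close> by (simp add: powr_def exp_add[symmetric] mult_ac)
    finally show ?thesis .
  qed
  show "\<exists>B\<in>events. {a \<in> space M. \<not> Z \<subseteq> (\<Union>k\<in>{n0..}. ball (\<omega> k a) (l k / 2))} \<subseteq> B \<and> prob B < e"
  proof (intro bexI conjI)
    show "(\<Union>z\<in>C. B z) \<in> events" using C B by auto
    have "prob (\<Union>z\<in>C. B z) \<le> (\<Sum>z\<in>C. prob (B z))"
      using C B by (intro finite_measure_subadditive_finite) auto
    also have "\<dots> \<le> real (card C) * (exp (4 * c) * real n powr (- c * p))"
      using prob_B by (intro sum_bounded_above) auto
    also have "\<dots> \<le> real n powr s * (exp (4 * c) * real n powr (- c * p))"
      using C by (intro mult_right_mono) auto
    also have "\<dots> = exp (4 * c) * real n powr (s - c * p)"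
      by (simp add: powr_add[symmetric])
    also note n(3)
    finally show "prob (\<Union>z\<in>C. B z) < e" .
    show "{a \<in> space M. \<not> Z \<subseteq> (\<Union>k\<in>{n0..}. ball (\<omega> k a) (l k / 2))} \<subseteq> (\<Union>z\<in>C. B z)"
    proof (rule subsetI)
      fix a assume "a \<in> {a \<in> space M. \<not> Z \<subseteq> (\<Union>k\<in>{n0..}. ball (\<omega> k a) (l k / 2))}"
      then obtain x where a: "a \<in> space M"
        and x: "x \<in> Z" "x \<notin> (\<Union>k\<in>{n0..}. ball (\<omega> k a) (l k / 2))" by blast
      obtain z where z: "z \<in> C" "dist z x < 2 / real n" using C x by auto
      have "\<omega> k a \<notin> ball z (l k / 2 - 2 / real n)" if "k \<in> {n0..n}" for k
      proof -
        have "l k / 2 \<le> dist (\<omega> k a) x" using x that by (auto simp: not_less)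
        then show ?thesis
          using z dist_triangle[of "\<omega> k a" x z] by (simp add: dist_commute)
      qed
      then have "a \<in> B z" using a by (auto simp: B_def)
      then show "a \<in> (\<Union>z\<in>C. B z)" using z(1) by blast
    qed
  qed
qed

text \<open>Every tail of the arcs covers \<open>Z\<close> almost surely, and countably many tails
  give the upper limit. The mass bound holds only up to radius \<open>r0\<close>, so lengths are
  first cut at \<open>2 * r0\<close>; a point covered by a shortened arc lies in the full
  one.\<close>

lemma AE_subset_limsup_arcs:
  assumes c: "0 \<le> c" "s < c * p" and "r0 > 0"
    and mass: "\<And>z r. \<lbrakk>z \<in> Z; 0 \<le> r; r \<le> r0\<rbrakk> \<Longrightarrow> 2 * c * r \<le> measure \<mu> (ball z r)"
    and net: "\<forall>\<^sub>F n in sequentially. \<exists>C. finite C \<and> C \<subseteq> Z \<and> real (card C) \<le> real n powr s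
      \<and> Z \<subseteq> (\<Union>z\<in>C. ball z (2 / real n))"
    and anti: "antimono_on {1..} l" and pos: "\<And>n. n \<ge> 1 \<Longrightarrow> 0 < l n"
    and p: "ereal p < log_average_limsup l"
  shows "AE a in M. Z \<subseteq> limsup (\<lambda>n. arc_interval (\<omega> n a) (l n))"
proof -
  \<comment> \<open>Tails start at \<open>Suc n\<close> because the assumptions on the arcs begin at
    index 1.\<close>
  have "AE a in M. Z \<subseteq> (\<Union>k\<in>{Suc n..}. ball (\<omega> k a) (min (l k) (2 * r0) / 2))" for n
    using c frequently_less_truncated_sum[OF anti pos _ p, of "2 * r0" "Suc n"] \<open>r0 > 0\<close>
    by (intro AE_subset_union_arcs[OF c _ mass net]) auto
  then have "AE a in M. \<forall>n. Z \<subseteq> (\<Union>k\<in>{Suc n..}. ball (\<omega> k a) (min (l k) (2 * r0) / 2))"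
    by (simp add: AE_all_countable)
  then show ?thesis
  proof eventually_elim
    case (elim a)
    show ?case
    proof
      fix x assume "x \<in> Z"
      have "\<exists>k\<ge>n. x \<in> ball (\<omega> k a) (l k / 2)" for n
      proof -
        obtain k where "k \<ge> Suc n" "x \<in> ball (\<omega> k a) (min (l k) (2 * r0) / 2)"
          using elim \<open>x \<in> Z\<close> by blast
        then show ?thesis by (intro exI[of _ k]) auto
      qed
      then show "x \<in> limsup (\<lambda>n. arc_interval (\<omega> n a) (l n))"
        by (simp add: mem_limsup_sets arc_interval_eq_ball)
    qed
  qed
qed

end

subsection \<open>Densities and the critical set\<close>

lemma AE_circle_lebesgue_iff:
  assumes "{x. P x} \<in> sets borel"
  shows "(AE x in circle_lebesgue. P x) \<longleftrightarrow> (AE t in lborel. t \<in> {0..<1} \<longrightarrow> P (to_circle t))"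
  unfolding circle_lebesgue_def using assms measurable_to_circle
  by (simp add: AE_distr_iff AE_restrict_space_iff)

lemma prob_density_measurable: "prob_density f \<Longrightarrow> f \<in> borel_measurable borel"
  by (auto simp: prob_density_def dest!: borel_measurable_integrable)

lemma sets_density_measure [simp, measurable_cong]: "sets (density_measure f) = sets borel"
  by (simp add: density_measure_def)

lemma prob_space_density_measure:
  assumes "prob_density f"
  shows "prob_space (density_measure f)"
proof
  have [measurable]: "f \<in> borel_measurable borel"
    using assms by (rule prob_density_measurable)
  have "emeasure (density_measure f) (space (density_measure f)) = (\<integral>\<^sup>+x. ennreal (f x) \<partial>circle_lebesgue)"
    by (simp add: density_measure_def emeasure_density)
  also have "\<dots> = ennreal (integral\<^sup>L circle_lebesgue f)"
    using assms by (intro nn_integral_eq_integral) (auto simp: prob_density_def)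
  also have "\<dots> = 1" using assms by (simp add: prob_density_def)
  finally show "emeasure (density_measure f) (space (density_measure f)) = 1" .
qed

lemma measure_density_ball_ge:
  assumes f: "prob_density f" and c: "0 \<le> c" "AE x in circle_lebesgue. x \<in> U \<longrightarrow> c \<le> f x"
    and r: "ball z r \<subseteq> U" "0 \<le> r" "r \<le> 1 / 2"
  shows "2 * c * r \<le> measure (density_measure f) (ball z r)"
proof -
  interpret prob_space "density_measure f" using f by (rule prob_space_density_measure)
  have [measurable]: "f \<in> borel_measurable borel"
    using f by (rule prob_density_measurable)
  have "ennreal (2 * c * r) = ennreal c * emeasure circle_lebesgue (ball z r)"
    using c r by (simp add: emeasure_circle_lebesgue_ball ennreal_mult[symmetric] mult_ac)
  also have "\<dots> = (\<integral>\<^sup>+x. ennreal c * indicator (ball z r) x \<partial>circle_lebesgue)"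
    by (simp add: nn_integral_cmult_indicator)
  also have "\<dots> \<le> (\<integral>\<^sup>+x. ennreal (f x) * indicator (ball z r) x \<partial>circle_lebesgue)"
    using c(2) r(1) by (intro nn_integral_mono_AE)
      (auto elim!: eventually_mono simp: indicator_def intro!: ennreal_leI split: if_splits)
  also have "\<dots> = emeasure (density_measure f) (ball z r)"
    by (simp add: density_measure_def emeasure_density)
  finally show ?thesis
    by (simp add: emeasure_eq_measure)
qed

section \<open>Essential infima and the minimal set\<close>

lemma AE_le_of_less_ess_inf:
  assumes "prob_density f" "c < ess_inf J f"
  shows "AE x in circle_lebesgue. x \<in> J \<longrightarrow> c \<le> f x"
proof -
  have "0 \<in> {a. AE x in circle_lebesgue. x \<in> J \<longrightarrow> a \<le> f x}"
    using assms(1) by (auto simp: prob_density_def)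
  then have "{a. AE x in circle_lebesgue. x \<in> J \<longrightarrow> a \<le> f x} \<noteq> {}" by blast
  from less_cSupD[OF this] assms(2)
  obtain a where "AE x in circle_lebesgue. x \<in> J \<longrightarrow> a \<le> f x" "c < a"
    unfolding ess_inf_def by blast
  then show ?thesis by (auto elim!: eventually_mono)
qed

text \<open>Were the bounds unbounded, \<open>f\<close> would exceed every natural number almost
  everywhere on \<open>J\<close>, so \<open>J\<close> would be null. Boundedness is what gives the
  real \<open>Sup\<close> in \<open>ess_inf\<close> its usual upper bound property.\<close>

lemma bdd_above_essential_lower_bounds:
  fixes f :: "circle \<Rightarrow> real"
  assumes "J \<in> sets borel" "emeasure circle_lebesgue J > 0"
  shows "bdd_above {a. AE x in circle_lebesgue. x \<in> J \<longrightarrow> a \<le> f x}"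
proof (rule ccontr)
  assume unbdd: "\<not> ?thesis"
  have "AE x in circle_lebesgue. x \<in> J \<longrightarrow> real n \<le> f x" for n
  proof -
    obtain a where "AE x in circle_lebesgue. x \<in> J \<longrightarrow> a \<le> f x" "real n < a"
      using unbdd unfolding bdd_above_def by (auto simp: not_le)
    then show ?thesis by (auto elim!: eventually_mono)
  qed
  then have "AE x in circle_lebesgue. \<forall>n. x \<in> J \<longrightarrow> real n \<le> f x"
    by (subst AE_all_countable) blast
  then have "AE x in circle_lebesgue. x \<notin> J"
  proof eventually_elim
    case (elim x)
    obtain n where "f x < real n" using reals_Archimedean2 by blast
    with elim show ?case using not_le by blast
  qed
  then have "emeasure circle_lebesgue J = 0"
    using assms(1) by (subst (asm) AE_iff_measurable[of J]) auto
  with assms(2) show False by simp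
qed

lemma emeasure_circle_lebesgue_UNIV: "emeasure circle_lebesgue UNIV = 1"
  using prob_space.emeasure_space_1[OF prob_space_circle_lebesgue] by simp

lemma min_density_nonneg:
  assumes "prob_density f"
  shows "0 \<le> min_density f"
  unfolding min_density_def ess_inf_def using assms
  by (intro cSup_upper bdd_above_essential_lower_bounds)
     (auto simp: prob_density_def emeasure_circle_lebesgue_UNIV)

lemma min_density_less_imp:
  fixes f :: "circle \<Rightarrow> real"
  assumes "min_density f < c"
  shows "\<not> (AE x in circle_lebesgue. c \<le> f x)"
proof
  assume "AE x in circle_lebesgue. c \<le> f x"
  then have "c \<le> min_density f"
    unfolding min_density_def ess_inf_def
    by (intro cSup_upper bdd_above_essential_lower_bounds)
      (auto simp: emeasure_circle_lebesgue_UNIV)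
  with assms show False by simp
qed

lemma min_density_le_ess_inf_ball:
  assumes "prob_density f" "r > 0"
  shows "min_density f \<le> ess_inf (ball x r) f"
proof -
  have "0 < ennreal (2 * min r (1 / 2))" using assms by simp
  also have "\<dots> = emeasure circle_lebesgue (ball x (min r (1 / 2)))"
    using assms by (subst emeasure_circle_lebesgue_ball) auto
  also have "\<dots> \<le> emeasure circle_lebesgue (ball x r)"
    by (intro emeasure_mono subset_ball) auto
  finally have "bdd_above {a. AE y in circle_lebesgue. y \<in> ball x r \<longrightarrow> a \<le> f y}"
    by (intro bdd_above_essential_lower_bounds) auto
  moreover have "0 \<in> {a. AE y in circle_lebesgue. y \<in> UNIV \<longrightarrow> a \<le> f y}"
    using assms(1) by (auto simp: prob_density_def)
  ultimately show ?thesis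
    unfolding min_density_def ess_inf_def by (intro cSup_subset_mono) auto
qed

text \<open>If all these essential infima equalled the global one, the sequence would converge to
  it. Any deviation is upward, since restricting to a ball cannot lower the essential
  infimum.\<close>

lemma not_in_min_set:
  assumes "prob_density f" "x \<notin> min_set f"
  obtains n where "n \<ge> 1" "min_density f < ess_inf (ball x (1 / real n)) f"
proof -
  \<comment> \<open>Requiring \<open>n \<ge> 1\<close> excludes \<open>1 / 0 = 0\<close>, whose ball
    is empty.\<close>
  have "\<exists>n\<ge>1. ess_inf (ball x (1 / real n)) f \<noteq> min_density f"
  proof (rule ccontr)
    assume "\<not> ?thesis"
    then have "\<forall>\<^sub>F n in sequentially. ess_inf (ball x (1 / real n)) f = min_density f"
      by (intro eventually_sequentiallyI[of 1]) auto
    then have "(\<lambda>n. ess_inf (ball x (1 / real n)) f) \<longlonglongrightarrow> min_density f"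
      by (rule tendsto_eventually)
    with assms(2) show False by (simp add: min_set_def)
  qed
  then obtain n where n: "n \<ge> 1" "ess_inf (ball x (1 / real n)) f \<noteq> min_density f" by blast
  then show ?thesis
    using min_density_le_ess_inf_ball[OF assms(1), of "1 / real n" x] by (intro that[of n]) auto
qed

text \<open>Each ball that meets \<open>Z\<close> is recentred at a point of \<open>Z\<close>, which
  at most doubles the radius. The union bound needs this because its mass estimate holds only at
  points of \<open>Z\<close>.\<close>

lemma net_with_centers_inside:
  fixes Z :: "'a::metric_space set"
  assumes "finite C" "Z \<subseteq> (\<Union>c\<in>C. ball c d)"
  obtains C' where "finite C'" "C' \<subseteq> Z" "card C' \<le> card C" "Z \<subseteq> (\<Union>c\<in>C'. ball c (2 * d))"
proof
  define g where "g c = (SOME z. z \<in> Z \<inter> ball c d)" for c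
  define C0 where "C0 = {c \<in> C. Z \<inter> ball c d \<noteq> {}}"
  have g: "g c \<in> Z \<inter> ball c d" if "c \<in> C0" for c
  proof -
    have "\<exists>z. z \<in> Z \<inter> ball c d" using that unfolding C0_def by blast
    then show ?thesis unfolding g_def by (rule someI_ex)
  qed
  have "finite C0" using assms by (simp add: C0_def)
  then show "finite (g ` C0)" by simp
  show "g ` C0 \<subseteq> Z" using g by blast
  have "card (g ` C0) \<le> card C0" using \<open>finite C0\<close> by (rule card_image_le)
  also have "\<dots> \<le> card C" using assms by (intro card_mono) (auto simp: C0_def)
  finally show "card (g ` C0) \<le> card C" .
  show "Z \<subseteq> (\<Union>c\<in>g ` C0. ball c (2 * d))"
  proof
    fix z assume "z \<in> Z"
    then obtain c where c: "c \<in> C" "z \<in> ball c d" using assms by blast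
    then have "c \<in> C0" using \<open>z \<in> Z\<close> unfolding C0_def by blast
    have "dist (g c) z \<le> dist c (g c) + dist c z" by (rule dist_triangle3)
    also have "\<dots> < 2 * d" using g[OF \<open>c \<in> C0\<close>] c by simp
    finally have "z \<in> ball (g c) (2 * d)" by simp
    then show "z \<in> (\<Union>c\<in>g ` C0. ball c (2 * d))" using \<open>c \<in> C0\<close> by blast
  qed
qed

text \<open>The exponent 1 is written as \<open>powr 1\<close> so that this net and the one from the
  box dimension fit the same covering lemma.\<close>

lemma eventually_linear_net:
  "\<forall>\<^sub>F n in sequentially. \<exists>C. finite C \<and> C \<subseteq> Z \<and> real (card C) \<le> real n powr 1
    \<and> Z \<subseteq> (\<Union>z\<in>C. ball z (2 / real n))" for Z :: "circle set"
proof (rule eventually_sequentiallyI[of 1])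
  fix n :: nat assume "1 \<le> n"
  then have "n > 0" by simp
  then obtain C0 :: "circle set" where C0: "finite C0" "card C0 \<le> n" "(\<Union>c\<in>C0. ball c (1 / real n)) = UNIV"
    by (rule circle_finite_net)
  have "Z \<subseteq> (\<Union>c\<in>C0. ball c (1 / real n))"
    unfolding C0(3) by (rule subset_UNIV)
  from net_with_centers_inside[OF C0(1) this]
  obtain C where C: "finite C" "C \<subseteq> Z" "card C \<le> card C0" "Z \<subseteq> (\<Union>c\<in>C. ball c (2 * (1 / real n)))" .
  moreover have "real (card C) \<le> real n powr 1" using C(3) C0(2) \<open>1 \<le> n\<close> by simp
  ultimately show "\<exists>C. finite C \<and> C \<subseteq> Z \<and> real (card C) \<le> real n powr 1
    \<and> Z \<subseteq> (\<Union>z\<in>C. ball z (2 / real n))" by (intro exI[of _ C] conjI) simp_all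
qed

lemma eventually_net_of_upper_box_dim:
  fixes Z :: "circle set"
  assumes "upper_box_dim Z < ereal s"
  shows "\<forall>\<^sub>F n in sequentially. \<exists>C. finite C \<and> C \<subseteq> Z \<and> real (card C) \<le> real n powr s
    \<and> Z \<subseteq> (\<Union>z\<in>C. ball z (2 / real n))"
proof -
  have "\<forall>\<^sub>F \<delta> in at_right 0. ereal (ln (real (covering_number Z \<delta>)) / - ln \<delta>) < ereal s"
    using assms unfolding upper_box_dim_def by (rule Limsup_lessD)
  moreover have "filterlim (\<lambda>n. 1 / real n) (at_right 0) sequentially"
    by real_asymp
  ultimately have "\<forall>\<^sub>F n in sequentially.
      ereal (ln (real (covering_number Z (1 / real n))) / - ln (1 / real n)) < ereal s"
    by (rule eventually_compose_filterlim)
  then show ?thesis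
    using eventually_ge_at_top[of 2]
  proof eventually_elim
    case (elim n)
    define N where "N = covering_number Z (1 / real n)"
    have "ln (real N) < s * ln (real n)"
      using elim by (simp add: N_def ln_div pos_divide_less_eq)
    then have N: "real N \<le> real n powr s"
    \<comment> \<open>The logarithm can be inverted by \<open>exp\<close> only for positive
      \<open>N\<close>; an empty \<open>Z\<close> gives \<open>N = 0\<close>.\<close>
    proof (cases "N = 0")
      case False
      then have "real N = exp (ln (real N))" by simp
      also have "\<dots> \<le> exp (s * ln (real n))" using \<open>ln (real N) < s * ln (real n)\<close> by simp
      finally show ?thesis using elim by (simp add: powr_def)
    qed simp
    have "n > 0" using elim by simp
    \<comment> \<open>A net of the whole circle shows that the \<open>LEAST\<close> in
      \<open>covering_number\<close> is attained.\<close>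
    then obtain C1 :: "circle set" where C1: "finite C1" "(\<Union>c\<in>C1. ball c (1 / real n)) = UNIV"
      by (rule circle_finite_net)
    have "Z \<subseteq> (\<Union>c\<in>C1. ball c (1 / real n))"
      unfolding C1(2) by (rule subset_UNIV)
    with C1(1) have "\<exists>k C. finite C \<and> card C = k \<and> Z \<subseteq> (\<Union>c\<in>C. ball c (1 / real n))" by blast
    from LeastI_ex[OF this]
    obtain C0 where C0: "finite C0" "card C0 = N" "Z \<subseteq> (\<Union>c\<in>C0. ball c (1 / real n))"
      unfolding N_def covering_number_def by blast
    from net_with_centers_inside[OF C0(1,3)]
    obtain C where C: "finite C" "C \<subseteq> Z" "card C \<le> card C0" "Z \<subseteq> (\<Union>c\<in>C. ball c (2 * (1 / real n)))" .
    moreover have "real (card C) \<le> real n powr s" using C(3) C0(2) N by simp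
    ultimately show ?case by (intro exI[of _ C] conjI) simp_all
  qed
qed

section \<open>Sufficient conditions for covering\<close>

locale random_density_centers = random_centers M \<omega> "density_measure f" for M :: "'a measure" and \<omega> f +
  assumes density: "prob_density f"
begin

lemma AE_subset_limsup_of_density:
  assumes c: "0 \<le> c" "s < c * p" and "r0 > 0"
    and U: "AE x in circle_lebesgue. x \<in> U \<longrightarrow> c \<le> f x" "\<And>z. z \<in> Z \<Longrightarrow> ball z r0 \<subseteq> U"
    and net: "\<forall>\<^sub>F n in sequentially. \<exists>C. finite C \<and> C \<subseteq> Z \<and> real (card C) \<le> real n powr s
      \<and> Z \<subseteq> (\<Union>z\<in>C. ball z (2 / real n))"
    and l: "antimono_on {1..} l" "\<And>n. n \<ge> 1 \<Longrightarrow> 0 < l n" "ereal p < log_average_limsup l"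
  shows "AE a in M. Z \<subseteq> limsup (\<lambda>n. arc_interval (\<omega> n a) (l n))"
proof (rule AE_subset_limsup_arcs[OF c _ _ net l])
  \<comment> \<open>Balls have measure \<open>2 * r\<close> only up to radius 1/2.\<close>
  show "0 < min r0 (1 / 2)" using \<open>r0 > 0\<close> by simp
  show "2 * c * r \<le> measure (density_measure f) (ball z r)"
    if "z \<in> Z" "0 \<le> r" "r \<le> min r0 (1 / 2)" for z r
  proof (rule measure_density_ball_ge[OF density c(1) U(1)])
    have "ball z r \<subseteq> ball z r0" using that by (intro subset_ball) auto
    then show "ball z r \<subseteq> U" using U(2)[OF that(1)] by blast
  qed (use that in auto)
qed

text \<open>The circle has nets of exponent 1, so \<open>c * p > 1\<close> suffices. The strict
  inequality leaves room for \<open>p\<close> between \<open>1 / m\<close> and the upper limit, and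
  then for \<open>c\<close> between \<open>1 / p\<close> and \<open>m\<close>, with
  \<open>m = min_density f\<close>.\<close>

lemma covered_if_greater:
  assumes m: "min_density f > 0" and gt: "log_average_limsup l > 1 / ereal (min_density f)"
    and l: "antimono_on {1..} l" "\<And>n. n \<ge> 1 \<Longrightarrow> 0 < l n"
  shows "dvoretzky_covered M \<omega> l"
proof -
  have "ereal (1 / min_density f) < log_average_limsup l"
    using gt m by (simp add: one_ereal_def)
  from ereal_dense2[OF this] obtain p where p: "1 / min_density f < p" "ereal p < log_average_limsup l"
    by auto
  have "0 < 1 / min_density f" using m by simp
  with p(1) have "p > 0" by linarith
  then have "1 / p < min_density f"
    using p m by (simp add: field_simps)
  from dense[OF this] obtain c where c: "1 / p < c" "c < min_density f" by blast
  have "0 < 1 / p" using \<open>p > 0\<close> by simp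
  with c(1) have "c > 0" by linarith
  have "AE a in M. UNIV \<subseteq> limsup (\<lambda>n. arc_interval (\<omega> n a) (l n))"
  proof (rule AE_subset_limsup_of_density[OF _ _ _ _ _ eventually_linear_net l p(2)])
    show "1 < c * p" using c \<open>p > 0\<close> by (simp add: field_simps)
    show "AE x in circle_lebesgue. x \<in> UNIV \<longrightarrow> c \<le> f x"
      using c(2) density unfolding min_density_def by (intro AE_le_of_less_ess_inf)
    show "(1 :: real) > 0" by simp
  qed (use \<open>c > 0\<close> in auto)
  then show ?thesis
    unfolding dvoretzky_covered_def by (simp add: top.extremum_unique)
qed

text \<open>Around a point outside the minimal set the density is at least some
  \<open>c > m\<close>, with \<open>m = min_density f\<close>. Then \<open>p\<close> fits between
  \<open>1 / c\<close> and \<open>1 / m\<close>, so the exponent 1 is affordable even when the upper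
  limit equals \<open>1 / m\<close>. Lindelof reduces to countably many balls.\<close>

lemma AE_complement_min_set_subset_limsup:
  assumes m: "min_density f > 0" and ge: "log_average_limsup l \<ge> 1 / ereal (min_density f)"
    and l: "antimono_on {1..} l" "\<And>n. n \<ge> 1 \<Longrightarrow> 0 < l n"
  shows "AE a in M. - min_set f \<subseteq> limsup (\<lambda>n. arc_interval (\<omega> n a) (l n))"
proof -
  \<comment> \<open>With the radius halved, a ball of this same radius around any point of a member
    stays where the density bound holds.\<close>
  define \<F> where "\<F> = {ball x (1 / (2 * real n)) | x n. n \<ge> 1 \<and> min_density f < ess_inf (ball x (1 / real n)) f}"
  have "open B" if "B \<in> \<F>" for B using that by (auto simp: \<F>_def)
  then obtain \<F>' where \<F>': "\<F>' \<subseteq> \<F>" "countable \<F>'" "\<Union>\<F>' = \<Union>\<F>" by (rule Lindelof)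
  have "AE a in M. B \<subseteq> limsup (\<lambda>n. arc_interval (\<omega> n a) (l n))" if in_F: "B \<in> \<F>" for B
  proof -
    obtain x n where B: "B = ball x (1 / (2 * real n))" and n: "n \<ge> 1"
      and less: "min_density f < ess_inf (ball x (1 / real n)) f"
      using in_F unfolding \<F>_def by blast
    from dense[OF less] obtain c where c: "min_density f < c" "c < ess_inf (ball x (1 / real n)) f" by blast
    then have "1 / c < 1 / min_density f"
      using m by (intro divide_strict_left_mono) auto
    from dense[OF this] obtain p where p: "1 / c < p" "p < 1 / min_density f" by blast
    have "c > 0" using c m by simp
    show ?thesis
    proof (rule AE_subset_limsup_of_density[OF _ _ _ _ _ eventually_linear_net l])
      show "1 < c * p" using p \<open>c > 0\<close> by (simp add: field_simps)
      show "AE x' in circle_lebesgue. x' \<in> ball x (1 / real n) \<longrightarrow> c \<le> f x'"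
        using c(2) density by (intro AE_le_of_less_ess_inf)
      show "1 / (2 * real n) > 0" using n by simp
      show "ball z (1 / (2 * real n)) \<subseteq> ball x (1 / real n)" if "z \<in> B" for z
      proof
        fix y assume "y \<in> ball z (1 / (2 * real n))"
        then have "dist x y < 1 / (2 * real n) + 1 / (2 * real n)"
          using that dist_triangle[of x y z] by (simp add: B)
        then show "y \<in> ball x (1 / real n)" by (simp add: field_simps)
      qed
      have "ereal p < 1 / ereal (min_density f)"
        using p m by (simp add: one_ereal_def)
      then show "ereal p < log_average_limsup l" using ge by simp
    qed (use \<open>c > 0\<close> in auto)
  qed
  then have "AE a in M. \<forall>B\<in>\<F>'. B \<subseteq> limsup (\<lambda>n. arc_interval (\<omega> n a) (l n))"
    using \<F>' by (subst AE_ball_countable) auto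
  moreover have "- min_set f \<subseteq> \<Union>\<F>'"
  proof
    fix x assume "x \<in> - min_set f"
    then obtain n where "n \<ge> 1" "min_density f < ess_inf (ball x (1 / real n)) f"
      using not_in_min_set[OF density, of x] by auto
    then have "ball x (1 / (2 * real n)) \<in> \<F>" "x \<in> ball x (1 / (2 * real n))"
      by (auto simp: \<F>_def)
    then show "x \<in> \<Union>\<F>'" unfolding \<F>'(3) by blast
  qed
  ultimately show ?thesis
    by (elim eventually_mono) (meson Sup_least order_trans)
qed

lemma covered_if_box_dim_less_1:
  assumes m: "min_density f > 0" and dim: "upper_box_dim (min_set f) < 1"
    and ge: "log_average_limsup l \<ge> 1 / ereal (min_density f)"
    and l: "antimono_on {1..} l" "\<And>n. n \<ge> 1 \<Longrightarrow> 0 < l n"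
  shows "dvoretzky_covered M \<omega> l"
proof -
  have "upper_box_dim (min_set f) < ereal 1"
    using dim by (simp add: one_ereal_def)
  from ereal_dense2[OF this] obtain s where s: "upper_box_dim (min_set f) < ereal s" "s < 1" by auto
  \<comment> \<open>\<open>s\<close> could be negative; \<open>v\<close> keeps \<open>u\<close>
    positive. The constants below are \<open>c = u * m\<close> and \<open>p = u / m\<close>, with
    \<open>m = min_density f\<close>: their product is \<open>u * u > s\<close>, while
    \<open>u < 1\<close> keeps \<open>c\<close> below \<open>m\<close> and \<open>p\<close> below
    \<open>1 / m\<close>.\<close>
  define v where "v = max s 0"
  define u where "u = (1 + v) / 2"
  have v: "s \<le> v" "0 \<le> v" "v < 1" using s by (auto simp: v_def)
  have "u\<^sup>2 - v = ((1 - v) / 2)\<^sup>2" by (simp add: u_def power2_eq_square field_simps)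
  also have "\<dots> > 0" using v by simp
  finally have "s < u * u" using v by (simp add: power2_eq_square)
  have u: "0 < u" "u < 1" using v by (auto simp: u_def)
  have "AE a in M. min_set f \<subseteq> limsup (\<lambda>n. arc_interval (\<omega> n a) (l n))"
  proof (rule AE_subset_limsup_of_density[OF _ _ _ _ _ eventually_net_of_upper_box_dim[OF s(1)] l])
    show "s < (u * min_density f) * (u / min_density f)" using \<open>s < u * u\<close> m by simp
    show "AE x in circle_lebesgue. x \<in> UNIV \<longrightarrow> u * min_density f \<le> f x"
      using u m density by (intro AE_le_of_less_ess_inf) (auto simp: min_density_def[symmetric])
    show "(1 :: real) > 0" by simp
    have "ereal (u / min_density f) < 1 / ereal (min_density f)"
      using u m by (simp add: one_ereal_def divide_strict_right_mono)
    then show "ereal (u / min_density f) < log_average_limsup l" using ge by simp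
  qed (use u m in auto)
  moreover have "AE a in M. - min_set f \<subseteq> limsup (\<lambda>n. arc_interval (\<omega> n a) (l n))"
    using m ge l by (rule AE_complement_min_set_subset_limsup)
  ultimately have "AE a in M. limsup (\<lambda>n. arc_interval (\<omega> n a) (l n)) = UNIV"
    by eventually_elim blast
  then show ?thesis by (simp add: dvoretzky_covered_def)
qed

end

subsection \<open>Points of small density\<close>

text \<open>One-sided Lebesgue differentiation, applied to \<open>F\<close> and to its reflection
  \<open>G\<close>, controls the averages over \<open>{t..t + h}\<close> and
  \<open>{t - h..t}\<close>; adding the two gives the symmetric interval.\<close>

lemma AE_lborel_symmetric_average_less:
  fixes F :: "real \<Rightarrow> real"
  assumes F: "integrable lborel F"
  shows "AE t in lborel. F t < c \<longrightarrow>
    (\<exists>d>0. \<forall>h. 0 < h \<and> h < d \<longrightarrow> (LINT u:{t - h..t + h}|lborel. F u) \<le> 2 * c * h)"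
proof -
  define G where "G t = F (- t)" for t
  have set_int: "set_integrable lborel {a..b} F" for a b
    using F unfolding set_integrable_def by (intro integrable_mult_indicator) auto
  have F_int: "F integrable_on {a..b}" for a b
    by (rule set_borel_integral_eq_integral[OF set_int])
  have G_int: "G integrable_on {a..b}" for a b
    using F_int[of "- b" "- a"] Henstock_Kurzweil_Integration.integrable_reflect_real[of F "- a" "- b"]
    by (simp add: G_def[abs_def])
  obtain N1 where N1: "negligible N1" "\<And>x e. \<lbrakk>x \<notin> N1; 0 < e\<rbrakk> \<Longrightarrow>
      \<exists>d>0. \<forall>h. 0 < h \<and> h < d \<longrightarrow> \<bar>integral {x..x + h} F / h - F x\<bar> < e"
    using integrable_ccontinuous_explicit[of F] F_int
    by (auto simp: divide_inverse mult.commute)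
  obtain N2 where N2: "negligible N2" "\<And>x e. \<lbrakk>x \<notin> N2; 0 < e\<rbrakk> \<Longrightarrow>
      \<exists>d>0. \<forall>h. 0 < h \<and> h < d \<longrightarrow> \<bar>integral {x..x + h} G / h - G x\<bar> < e"
    using integrable_ccontinuous_explicit[of G] G_int
    by (auto simp: divide_inverse mult.commute)
  have AE_not_in: "AE t in lborel. t \<notin> N" if "negligible N" for N :: "real set"
    using that AE_not_in[of N lebesgue] by (simp add: negligible_iff_null_sets AE_completion_iff)
  \<comment> \<open>The exceptional set of \<open>G\<close> is reflected back, which preserves
    Lebesgue measure.\<close>
  have "AE t in lborel. - t \<notin> N2"
  proof (rule AE_distrD[of uminus _ borel])
    show "AE t in distr lborel borel uminus. t \<notin> N2"
      unfolding lborel_distr_uminus using N2(1) by (rule AE_not_in)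
  qed simp
  with AE_not_in[OF N1(1)] show ?thesis
  proof eventually_elim
    case (elim t)
    show ?case
    proof
      assume "F t < c"
      then have e: "0 < c - F t" by simp
      obtain d1 where d1: "d1 > 0"
        "\<And>h. 0 < h \<and> h < d1 \<Longrightarrow> \<bar>integral {t..t + h} F / h - F t\<bar> < c - F t"
        using N1(2)[OF elim(1) e] by blast
      obtain d2 where d2: "d2 > 0"
        "\<And>h. 0 < h \<and> h < d2 \<Longrightarrow> \<bar>integral {- t..- t + h} G / h - G (- t)\<bar> < c - F t"
        using N2(2)[OF elim(2) e] by blast
      have "(LINT u:{t - h..t + h}|lborel. F u) \<le> 2 * c * h" if h: "0 < h" "h < min d1 d2" for h
      proof -
        have "integral {t..t + h} F / h < c" using d1(2)[of h] h by linarith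
        then have right: "integral {t..t + h} F < c * h"
          using h by (simp add: pos_divide_less_eq)
        have "integral {- t..- t + h} G = integral {- t..- (t - h)} (\<lambda>u. F (- u))"
          by (simp add: G_def[abs_def] algebra_simps)
        also have "\<dots> = integral {t - h..t} F"
          by (rule Henstock_Kurzweil_Integration.integral_reflect_real)
        finally have "integral {t - h..t} F / h < c"
          using d2(2)[of h] h unfolding G_def by simp
        then have left: "integral {t - h..t} F < c * h"
          using h by (simp add: pos_divide_less_eq)
        have "(LINT u:{t - h..t + h}|lborel. F u) = integral {t - h..t + h} F"
          by (rule set_borel_integral_eq_integral[OF set_int])
        also have "\<dots> = integral {t - h..t} F + integral {t..t + h} F"
          using h by (intro Henstock_Kurzweil_Integration.integral_combine[symmetric] F_int) auto
        also have "\<dots> \<le> 2 * c * h" using left right by simp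
        finally show ?thesis .
      qed
      then show "\<exists>d>0. \<forall>h. 0 < h \<and> h < d \<longrightarrow> (LINT u:{t - h..t + h}|lborel. F u) \<le> 2 * c * h"
        using d1(1) d2(1) by (intro exI[of _ "min d1 d2"]) auto
    qed
  qed
qed

text \<open>A smaller ball around a limit point lies in the ball of radius \<open>r\<close> around a
  nearby point of the sequence, so its mass is at most \<open>b * r\<close>. Open balls are
  increasing unions of smaller concentric ones, so continuity from below gives radius
  \<open>r\<close> itself.\<close>

lemma closed_small_ball_mass:
  fixes \<mu> :: "'b::metric_space measure"
  assumes "finite_measure \<mu>" and sets: "sets \<mu> = sets borel"
  shows "closed {x. \<forall>r. 0 < r \<and> r < d \<longrightarrow> measure \<mu> (ball x r) \<le> b * r}"
  unfolding closed_sequential_limits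
proof safe
  interpret finite_measure \<mu> by fact
  fix X x r
  assume X: "\<forall>n. X n \<in> {x. \<forall>r. 0 < r \<and> r < d \<longrightarrow> measure \<mu> (ball x r) \<le> b * r}"
    and lim: "X \<longlonglongrightarrow> x" and r: "0 < r" "r < d"
  have le: "measure \<mu> (ball x r') \<le> b * r" if "r' < r" for r'
  proof -
    obtain n where n: "dist (X n) x < r - r'"
      using metric_LIMSEQ_D[OF lim, of "r - r'"] \<open>r' < r\<close> by auto
    have "ball x r' \<subseteq> ball (X n) r"
    proof
      fix y assume "y \<in> ball x r'"
      then show "y \<in> ball (X n) r" using n dist_triangle[of "X n" y x] by simp
    qed
    then have "measure \<mu> (ball x r') \<le> measure \<mu> (ball (X n) r)"
      by (intro finite_measure_mono) (auto simp: sets)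
    also have "\<dots> \<le> b * r" using X r by blast
    finally show ?thesis .
  qed
  define R where "R j = r - r / real (Suc j)" for j
  have R: "R j < r" for j using r by (simp add: R_def)
  have "incseq (\<lambda>j. ball x (R j))"
    using r by (intro incseq_SucI subset_ball) (simp add: R_def frac_le)
  moreover have "(\<Union>j. ball x (R j)) = ball x r"
  proof
    show "(\<Union>j. ball x (R j)) \<subseteq> ball x r"
      using R by (intro UN_least subset_ball less_imp_le)
    show "ball x r \<subseteq> (\<Union>j. ball x (R j))"
    proof
      fix y assume y: "y \<in> ball x r"
      then have "0 < (r - dist x y) / r" using r by simp
      then obtain j where "1 / real (Suc j) < (r - dist x y) / r" by (rule nat_approx_posE)
      then have "dist x y < R j" using r by (simp add: R_def field_simps del: of_nat_Suc)
      then show "y \<in> (\<Union>j. ball x (R j))" by auto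
    qed
  qed
  ultimately have "(\<lambda>j. measure \<mu> (ball x (R j))) \<longlonglongrightarrow> measure \<mu> (ball x r)"
    using finite_Lim_measure_incseq[of "\<lambda>j. ball x (R j)"] by (simp add: sets image_subset_iff)
  then show "measure \<mu> (ball x r) \<le> b * r"
    by (rule LIMSEQ_le_const2) (use le R in blast)
qed

text \<open>By differentiation almost every point with \<open>f < c\<close> lies in some
  \<open>E k\<close>, where \<open>k\<close> records the scale below which the mass bound holds. If
  all \<open>E k\<close> were null, then \<open>c \<le> f\<close> would hold almost everywhere.
  Closedness will supply compactness.\<close>

lemma exists_closed_small_density:
  assumes f: "prob_density f" and c: "\<not> (AE x in circle_lebesgue. c \<le> f x)"
  obtains E d where "closed E" "emeasure circle_lebesgue E > 0" "d > 0"
    "\<And>x r. \<lbrakk>x \<in> E; 0 < r; r < d\<rbrakk> \<Longrightarrow> measure (density_measure f) (ball x r) \<le> 2 * c * r"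
proof -
  define \<mu> where "\<mu> = density_measure f"
  interpret \<mu>: prob_space \<mu> unfolding \<mu>_def using f by (rule prob_space_density_measure)
  have [measurable]: "f \<in> borel_measurable borel"
    using f by (rule prob_density_measurable)
  define E where "E k = {x. \<forall>r. 0 < r \<and> r < 1 / real (Suc k) \<longrightarrow> measure \<mu> (ball x r) \<le> 2 * c * r}" for k
  have closed: "closed (E k)" for k
    unfolding E_def by (rule closed_small_ball_mass) (auto simp: \<mu>_def intro: \<mu>.finite_measure_axioms[unfolded \<mu>_def])
  define F where "F t = indicator {0..<1} t *\<^sub>R f (to_circle t)" for t :: real
  have F_integrable: "integrable lborel F"
  proof -
    have "integrable (restrict_space lborel {0..<1}) (\<lambda>t. f (to_circle t))"
      using f measurable_to_circle unfolding prob_density_def circle_lebesgue_def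
      by (subst (asm) integrable_distr_eq) auto
    then show ?thesis
      unfolding F_def[abs_def] by (subst (asm) integrable_restrict_space) auto
  qed
  have F_nonneg: "AE t in lborel. 0 \<le> F t"
  proof -
    have "AE t in lborel. t \<in> {0..<1} \<longrightarrow> 0 \<le> f (to_circle t)"
      using f by (subst AE_circle_lebesgue_iff[symmetric]) (auto simp: prob_density_def)
    then show ?thesis by eventually_elim (simp add: F_def indicator_def)
  qed
  \<comment> \<open>These constraints on \<open>h\<close> keep the ball from wrapping, so its mass
    is bounded by an integral over one interval.\<close>
  have mass: "measure \<mu> (ball (to_circle t) h) \<le> (LINT u:{t - h..t + h}|lborel. F u)"
    if t: "0 < h" "h < t" "t + h < 1" for t h
  proof -
    have vimage: "to_circle -` ball (to_circle t) h \<inter> {0..<1} \<subseteq> {t - h..t + h}"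
      using t by (subst vimage_ball_to_circle) auto
    have [measurable]: "ball (to_circle t) h \<in> sets borel" by simp
    have "emeasure \<mu> (ball (to_circle t) h)
        = (\<integral>\<^sup>+u. ennreal (f (to_circle u)) * indicator (ball (to_circle t) h) (to_circle u)
            * indicator {0..<1} u \<partial>lborel)"
      unfolding \<mu>_def density_measure_def
      by (subst emeasure_density, simp, simp, rule nn_integral_circle_lebesgue) measurable
    also have "\<dots> \<le> (\<integral>\<^sup>+u. ennreal (indicator {t - h..t + h} u *\<^sub>R F u) \<partial>lborel)"
      using vimage by (intro nn_integral_mono) (auto simp: F_def indicator_def)
    also have "\<dots> = ennreal (LINT u:{t - h..t + h}|lborel. F u)"
      unfolding set_lebesgue_integral_def
      using F_integrable F_nonneg
      by (intro nn_integral_eq_integral integrable_mult_indicator) (auto elim!: eventually_mono)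
    finally have "ennreal (measure \<mu> (ball (to_circle t) h)) \<le> ennreal (LINT u:{t - h..t + h}|lborel. F u)"
      by (simp add: \<mu>.emeasure_eq_measure)
    moreover have "0 \<le> (LINT u:{t - h..t + h}|lborel. F u)"
      unfolding set_lebesgue_integral_def
      using F_nonneg by (intro integral_nonneg_AE) (auto elim!: eventually_mono)
    ultimately show ?thesis by simp
  qed
  have "\<exists>k. emeasure circle_lebesgue (E k) \<noteq> 0"
  proof (rule ccontr)
    assume "\<not> ?thesis"
    then have "E k \<in> null_sets circle_lebesgue" for k
      using closed by (auto intro: null_setsI)
    then have "(\<Union>k. E k) \<in> null_sets circle_lebesgue" by auto
    then have "AE x in circle_lebesgue. x \<notin> (\<Union>k. E k)" by (rule AE_not_in)
    moreover have "- (\<Union>k. E k) \<in> sets borel"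
      using closed by (intro borel_comp sets.countable_UN) auto
    then have "{x. x \<notin> (\<Union>k. E k)} \<in> sets borel" by (simp only: Compl_eq)
    ultimately have "AE t in lborel. t \<in> {0..<1} \<longrightarrow> to_circle t \<notin> (\<Union>k. E k)"
      using AE_circle_lebesgue_iff by blast
    \<comment> \<open>The point 0 is discarded, since every ball around it wraps.\<close>
    then have "AE t in lborel. t \<in> {0..<1} \<longrightarrow> c \<le> f (to_circle t)"
      using AE_lborel_symmetric_average_less[OF F_integrable, of c] AE_lborel_singleton[of 0]
    proof eventually_elim
      case (elim t)
      show ?case
      proof (rule impI, rule ccontr)
        assume t: "t \<in> {0..<1}" and "\<not> c \<le> f (to_circle t)"
        then have "F t < c" by (simp add: F_def)
        with elim obtain d where d: "d > 0"
          "\<And>h. 0 < h \<Longrightarrow> h < d \<Longrightarrow> (LINT u:{t - h..t + h}|lborel. F u) \<le> 2 * c * h" by blast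
        have "0 < Min {d, t, 1 - t}" using d t elim by auto
        then obtain k where k: "1 / real (Suc k) < Min {d, t, 1 - t}" by (rule nat_approx_posE)
        have "to_circle t \<in> E k"
          unfolding E_def
        proof safe
          fix r :: real assume "0 < r" "r < 1 / real (Suc k)"
          then have "r < d" "r < t" "t + r < 1" using k by auto
          then show "measure \<mu> (ball (to_circle t) r) \<le> 2 * c * r"
            using mass[of r t] d(2)[of r] \<open>0 < r\<close> by linarith
        qed
        then show False using elim t by blast
      qed
    qed
    then have "AE x in circle_lebesgue. c \<le> f x"
      by (subst AE_circle_lebesgue_iff) auto
    with c show False by contradiction
  qed
  then obtain k where "emeasure circle_lebesgue (E k) \<noteq> 0" ..
  then show ?thesis
    using closed[of k] by (intro that[of "E k" "1 / real (Suc k)"])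
      (auto simp: E_def \<mu>_def zero_less_iff_neq_zero simp del: of_nat_Suc)
qed

subsection \<open>Second moment of the uncovered set\<close>

text \<open>Multiplying in factor \<open>n\<close> adds \<open>\<kappa> * l n\<close> times the
  product so far, and only if \<open>d < l n\<close>; the product so far is bounded by dropping its
  indicators. The resulting sum can be integrated term by term.\<close>

lemma prod_kernel_le:
  fixes d :: real and l :: "nat \<Rightarrow> real"
  assumes "\<kappa> \<ge> 0" "\<And>n. n \<ge> n0 \<Longrightarrow> l n \<ge> 0"
  shows "(\<Prod>n=n0..N. 1 + \<kappa> * l n * of_bool (d < l n)) \<le>
    1 + (\<Sum>n=n0..N. \<kappa> * l n * (\<Prod>k=n0..<n. 1 + \<kappa> * l k) * of_bool (d < l n))"
proof (cases "n0 \<le> N")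
  case True
  have nonneg: "0 \<le> \<kappa> * l n" if "n \<ge> n0" for n using assms that by simp
  define P where "P n = (\<Prod>k=n0..<n. 1 + \<kappa> * l k * of_bool (d < l k))" for n
  define A where "A n = (\<Prod>k=n0..<n. 1 + \<kappa> * l k)" for n
  have PA: "P n \<le> A n" for n
    unfolding P_def A_def using nonneg by (intro prod_mono) (auto simp: add_nonneg_nonneg)
  have "P (Suc n) \<le> 1 + (\<Sum>n=n0..n. \<kappa> * l n * A n * of_bool (d < l n))" if "n0 \<le> n" for n
    using that
  proof (induction n rule: dec_induct)
    case base
    show ?case by (simp add: P_def A_def)
  next
    case (step n)
    have "P (Suc (Suc n)) = P (Suc n) + \<kappa> * l (Suc n) * P (Suc n) * of_bool (d < l (Suc n))"
      using step.hyps by (simp add: P_def algebra_simps)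
    also have "\<dots> \<le> P (Suc n) + \<kappa> * l (Suc n) * A (Suc n) * of_bool (d < l (Suc n))"
      using PA[of "Suc n"] nonneg[of "Suc n"] step.hyps
      by (intro add_left_mono mult_right_mono mult_left_mono) auto
    finally show ?case using step by simp
  qed
  from this[OF True] show ?thesis
    by (simp add: P_def A_def atLeastLessThanSuc_atLeastAtMost)
qed simp

context random_centers
begin

lemma nn_integral_prod_centers:
  assumes "finite I" "I \<subseteq> {1..}" and g: "\<And>n. n \<in> I \<Longrightarrow> g n \<in> borel_measurable borel"
  shows "(\<integral>\<^sup>+a. (\<Prod>n\<in>I. g n (\<omega> n a)) \<partial>M) = (\<Prod>n\<in>I. \<integral>\<^sup>+w. g n w \<partial>\<mu>)"
proof -
  have "indep_vars (\<lambda>_. borel) (\<lambda>n a. g n (\<omega> n a)) I"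
    using indep_vars_subset[OF indep assms(2)] g by (rule indep_vars_compose2)
  then have "(\<integral>\<^sup>+a. (\<Prod>n\<in>I. g n (\<omega> n a)) \<partial>M) = (\<Prod>n\<in>I. \<integral>\<^sup>+a. g n (\<omega> n a) \<partial>M)"
    using assms(1) by (intro indep_vars_nn_integral) auto
  also have "\<dots> = (\<Prod>n\<in>I. \<integral>\<^sup>+w. g n w \<partial>\<mu>)"
  proof (intro prod.cong refl)
    fix n assume n: "n \<in> I"
    then have "n \<ge> 1" using assms by auto
    with n g show "(\<integral>\<^sup>+a. g n (\<omega> n a) \<partial>M) = (\<integral>\<^sup>+w. g n w \<partial>\<mu>)"
      by (subst distr_eq[of n, symmetric]) (auto simp: nn_integral_distr)
  qed
  finally show ?thesis .
qed

text \<open>Normalised to have integral one in \<open>w\<close>, whatever \<open>x\<close> is.\<close>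

definition avoid :: "real \<Rightarrow> circle \<Rightarrow> circle \<Rightarrow> ennreal"
  where "avoid r x w = (if dist x w < r then 0 else ennreal (1 / (1 - measure \<mu> (ball x r))))"

text \<open>The mass is the integral over \<open>w\<close> of a jointly measurable indicator, hence
  measurable in the centre.\<close>

lemma measurable_ball_mass [measurable]: "(\<lambda>x. measure \<mu> (ball x r)) \<in> borel_measurable borel"
proof -
  interpret \<mu>: prob_space \<mu> by (rule prob_space_distribution)
  have "emeasure \<mu> (ball x r) = (\<integral>\<^sup>+w. indicator {w. dist x w < r} w \<partial>\<mu>)" for x
    by (subst nn_integral_indicator) (auto simp: ball_def[symmetric])
  then have "measure \<mu> (ball x r) = enn2real (\<integral>\<^sup>+w. indicator {w. dist x w < r} w \<partial>\<mu>)" for x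
    by (simp add: measure_def)
  moreover have "(\<lambda>x. \<integral>\<^sup>+w. indicator {w. dist x w < r} w \<partial>\<mu>) \<in> borel_measurable borel"
    unfolding indicator_def mem_Collect_eq by measurable
  ultimately show ?thesis by simp
qed

lemma measurable_avoid [measurable]:
  assumes [measurable]: "g \<in> N \<rightarrow>\<^sub>M borel" "h \<in> N \<rightarrow>\<^sub>M borel"
  shows "(\<lambda>z. avoid r (g z) (h z)) \<in> borel_measurable N"
  unfolding avoid_def by measurable

lemma nn_integral_avoid:
  assumes "measure \<mu> (ball x r) < 1"
  shows "(\<integral>\<^sup>+w. avoid r x w \<partial>\<mu>) = 1"
proof -
  interpret \<mu>: prob_space \<mu> by (rule prob_space_distribution)
  have space: "space \<mu> = UNIV" using sets_eq_imp_space_eq[OF sets_distribution] by simp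
  have "(\<integral>\<^sup>+w. avoid r x w \<partial>\<mu>)
      = (\<integral>\<^sup>+w. ennreal (1 / (1 - measure \<mu> (ball x r))) * indicator (- ball x r) w \<partial>\<mu>)"
    by (intro nn_integral_cong) (auto simp: avoid_def indicator_def)
  also have "\<dots> = ennreal (1 / (1 - measure \<mu> (ball x r))) * emeasure \<mu> (- ball x r)"
    by (subst nn_integral_cmult_indicator) auto
  also have "emeasure \<mu> (- ball x r) = ennreal (1 - measure \<mu> (ball x r))"
    using \<mu>.prob_compl[of "ball x r"] by (simp add: \<mu>.emeasure_eq_measure space Compl_eq_Diff_UNIV)
  finally show ?thesis
    using assms by (simp add: ennreal_mult[symmetric])
qed

text \<open>With \<open>p\<close>, \<open>p'\<close> and \<open>i\<close> the masses of the balls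
  and of their intersection, the integral is \<open>(1 - p - p' + i) / ((1 - p) * (1 - p'))\<close>,
  at most \<open>1 + i / ((1 - p) * (1 - p'))\<close>. The balls are disjoint, and
  \<open>i = 0\<close>, once the centres are \<open>2 * r\<close> apart.\<close>

lemma nn_integral_avoid_avoid_le:
  assumes b: "measure \<mu> (ball x r) \<le> b" "measure \<mu> (ball y r) \<le> b" "b < 1"
    and q: "b / (1 - b)\<^sup>2 \<le> q"
  shows "(\<integral>\<^sup>+w. avoid r x w * avoid r y w \<partial>\<mu>) \<le> ennreal (1 + q * of_bool (dist x y < 2 * r))"
proof -
  interpret \<mu>: prob_space \<mu> by (rule prob_space_distribution)
  have space: "space \<mu> = UNIV" using sets_eq_imp_space_eq[OF sets_distribution] by simp
  define p where "p = measure \<mu> (ball x r)"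
  define p' where "p' = measure \<mu> (ball y r)"
  define i where "i = measure \<mu> (ball x r \<inter> ball y r)"
  have p: "0 \<le> p" "p \<le> b" "0 \<le> p'" "p' \<le> b" using b by (auto simp: p_def p'_def)
  have i: "0 \<le> i" "i \<le> b * of_bool (dist x y < 2 * r)"
  proof -
    show "0 \<le> i" by (simp add: i_def)
    show "i \<le> b * of_bool (dist x y < 2 * r)"
    proof (cases "dist x y < 2 * r")
      case True
      have "i \<le> p" unfolding i_def p_def by (intro \<mu>.finite_measure_mono) auto
      with p True show ?thesis by simp
    next
      case False
      have "ball x r \<inter> ball y r = {}"
      proof (rule ccontr)
        assume "\<not> ?thesis"
        then obtain z where "dist x z < r" "dist y z < r" by auto
        with False dist_triangle2[of x y z] show False by simp
      qed
      then show ?thesis using False by (simp add: i_def)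
    qed
  qed
  have "(\<integral>\<^sup>+w. avoid r x w * avoid r y w \<partial>\<mu>)
      = (\<integral>\<^sup>+w. ennreal (1 / (1 - p) * (1 / (1 - p'))) * indicator (- (ball x r \<union> ball y r)) w \<partial>\<mu>)"
    using p b(3) by (intro nn_integral_cong)
      (auto simp: avoid_def indicator_def ennreal_mult[symmetric] p_def[symmetric] p'_def[symmetric])
  also have "\<dots> = ennreal (1 / (1 - p) * (1 / (1 - p'))) * emeasure \<mu> (- (ball x r \<union> ball y r))"
    by (subst nn_integral_cmult_indicator) auto
  also have "emeasure \<mu> (- (ball x r \<union> ball y r)) = ennreal (1 - p - p' + i)"
  proof -
    have "measure \<mu> (- (ball x r \<union> ball y r)) = 1 - measure \<mu> (ball x r \<union> ball y r)"
      using \<mu>.prob_compl[of "ball x r \<union> ball y r"] by (simp add: space Compl_eq_Diff_UNIV)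
    also have "measure \<mu> (ball x r \<union> ball y r) = p + p' - i"
      unfolding p_def p'_def i_def by (intro measure_Un3) (auto simp: fmeasurable_def \<mu>.emeasure_eq_measure)
    also have "1 - (p + p' - i) = 1 - p - p' + i" by simp
    finally show ?thesis by (simp only: \<mu>.emeasure_eq_measure)
  qed
  also have "ennreal (1 / (1 - p) * (1 / (1 - p'))) * ennreal (1 - p - p' + i)
      = ennreal ((1 - p - p' + i) / ((1 - p) * (1 - p')))"
    using p b(3) by (subst ennreal_mult'[symmetric]) auto
  also have "\<dots> \<le> ennreal (1 + q * of_bool (dist x y < 2 * r))"
  proof (rule ennreal_leI)
    have pos: "0 < (1 - b)\<^sup>2" "(1 - b)\<^sup>2 \<le> (1 - p) * (1 - p')"
      using p b(3) unfolding power2_eq_square by (auto intro!: mult_mono)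
    have "1 - p - p' + i \<le> (1 - p) * (1 - p') + i"
      using p by (simp add: algebra_simps)
    then have "(1 - p - p' + i) / ((1 - p) * (1 - p')) \<le> ((1 - p) * (1 - p') + i) / ((1 - p) * (1 - p'))"
      using pos by (intro divide_right_mono) linarith+
    also have "\<dots> = 1 + i / ((1 - p) * (1 - p'))"
      using p b(3) by (simp add: add_divide_distrib)
    also have "i / ((1 - p) * (1 - p')) \<le> i / (1 - b)\<^sup>2"
      using pos i p b(3) by (intro divide_left_mono mult_pos_pos) linarith+
    also have "\<dots> \<le> b * of_bool (dist x y < 2 * r) / (1 - b)\<^sup>2"
      using i by (intro divide_right_mono) auto
    also have "\<dots> \<le> q * of_bool (dist x y < 2 * r)"
      using q by (cases "dist x y < 2 * r") auto
    finally show "(1 - p - p' + i) / ((1 - p) * (1 - p')) \<le> 1 + q * of_bool (dist x y < 2 * r)"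
      by simp
  qed
  finally show ?thesis .
qed

text \<open>A Paley-Zygmund argument: \<open>X\<close> has mean \<open>e\<close> and second moment
  at most \<open>1 + S\<close>, so it is nonzero with probability at least
  \<open>e\<^sup>2 / (1 + S)\<close>, and \<open>X a \<noteq> 0\<close> forces a missed point of
  \<open>E\<close>.\<close>

lemma prob_uncovered_ge:
  fixes l :: "nat \<Rightarrow> real"
  assumes "n0 \<ge> 1" and [measurable]: "E \<in> sets borel"
    and \<kappa>: "\<kappa> \<ge> 0" and l: "\<And>n. n \<ge> n0 \<Longrightarrow> 0 \<le> l n \<and> c * l n < 1 \<and> c / (1 - c * l n)\<^sup>2 \<le> \<kappa>"
    and mass: "\<And>n x. \<lbrakk>n \<ge> n0; x \<in> E\<rbrakk> \<Longrightarrow> measure \<mu> (ball x (l n / 2)) \<le> c * l n"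
    and S: "(\<Sum>n=n0..N. 2 * \<kappa> * (l n)\<^sup>2 * (\<Prod>k=n0..<n. 1 + \<kappa> * l k)) \<le> S" "0 \<le> S"
    and e: "e = measure circle_lebesgue E" "e > 0"
  obtains G where "G \<in> events" "e\<^sup>2 / (1 + S) \<le> prob G"
    "\<And>a. a \<in> G \<Longrightarrow> \<exists>x\<in>E. \<forall>n\<in>{n0..N}. x \<notin> ball (\<omega> n a) (l n / 2)"
proof -
  interpret L: prob_space circle_lebesgue by (rule prob_space_circle_lebesgue)
  interpret prod: pair_sigma_finite M circle_lebesgue by unfold_locales
  have [measurable]: "\<omega> n \<in> M \<rightarrow>\<^sub>M borel" if "n \<in> {n0..N}" for n
    using that \<open>n0 \<ge> 1\<close> by (intro center_measurable) auto
  \<comment> \<open>Nonzero only at points of \<open>E\<close> missed by all arcs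
    \<open>n0..N\<close>, and of mean 1 at each point of \<open>E\<close>.\<close>
  define Q where "Q a x = (\<Prod>n=n0..N. avoid (l n / 2) x (\<omega> n a)) * indicator E x" for a x
  have [measurable]: "(\<lambda>z. Q (g z) (h z)) \<in> borel_measurable K"
    if meas [measurable]: "g \<in> K \<rightarrow>\<^sub>M M" "h \<in> K \<rightarrow>\<^sub>M borel" for g h and K :: "'k measure"
    unfolding Q_def by measurable
  define X where "X a = (\<integral>\<^sup>+x. Q a x \<partial>circle_lebesgue)" for a
  have [measurable]: "X \<in> borel_measurable M"
    unfolding X_def by measurable
  have EX: "(\<integral>\<^sup>+a. X a \<partial>M) = ennreal e"
  proof -
    have "(\<integral>\<^sup>+a. X a \<partial>M) = (\<integral>\<^sup>+x. \<integral>\<^sup>+a. Q a x \<partial>M \<partial>circle_lebesgue)"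
      unfolding X_def by (rule prod.Fubini'[symmetric]) measurable
    also have "\<dots> = (\<integral>\<^sup>+x. indicator E x \<partial>circle_lebesgue)"
    proof (rule nn_integral_cong)
      fix x
      have "(\<integral>\<^sup>+a. Q a x \<partial>M) = (\<integral>\<^sup>+a. (\<Prod>n=n0..N. avoid (l n / 2) x (\<omega> n a)) \<partial>M) * indicator E x"
        unfolding Q_def by (rule nn_integral_multc) measurable
      also have "\<dots> = (\<Prod>n=n0..N. \<integral>\<^sup>+w. avoid (l n / 2) x w \<partial>\<mu>) * indicator E x"
        using \<open>n0 \<ge> 1\<close> by (subst nn_integral_prod_centers) auto
      also have "\<dots> = indicator E x"
      proof (cases "x \<in> E")
        case True
        have "(\<integral>\<^sup>+w. avoid (l n / 2) x w \<partial>\<mu>) = 1" if "n \<in> {n0..N}" for n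
          using that mass[OF _ True, of n] l[of n] by (intro nn_integral_avoid) auto
        then show ?thesis by simp
      qed simp
      finally show "(\<integral>\<^sup>+a. Q a x \<partial>M) = indicator E x" .
    qed
    also have "\<dots> = ennreal e" by (simp add: e L.emeasure_eq_measure)
    finally show ?thesis .
  qed
  have kernel: "(\<integral>\<^sup>+a. Q a x * Q a y \<partial>M) \<le>
      ennreal (1 + (\<Sum>n=n0..N. \<kappa> * l n * (\<Prod>k=n0..<n. 1 + \<kappa> * l k) * of_bool (dist x y < l n)))" for x y
  proof (cases "x \<in> E \<and> y \<in> E")
    case True
    then have "(\<integral>\<^sup>+a. Q a x * Q a y \<partial>M) =
        (\<integral>\<^sup>+a. (\<Prod>n=n0..N. avoid (l n / 2) x (\<omega> n a) * avoid (l n / 2) y (\<omega> n a)) \<partial>M)"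
      by (simp add: Q_def prod.distrib)
    also have "\<dots> = (\<Prod>n=n0..N. \<integral>\<^sup>+w. avoid (l n / 2) x w * avoid (l n / 2) y w \<partial>\<mu>)"
      using \<open>n0 \<ge> 1\<close> by (intro nn_integral_prod_centers) auto
    also have "\<dots> \<le> (\<Prod>n=n0..N. ennreal (1 + \<kappa> * l n * of_bool (dist x y < l n)))"
    proof (rule prod_mono_ennreal)
      fix n assume n: "n \<in> {n0..N}"
      have "c * l n / (1 - c * l n)\<^sup>2 \<le> \<kappa> * l n"
        using mult_right_mono[of "c / (1 - c * l n)\<^sup>2" \<kappa> "l n"] l[of n] n by simp
      then show "(\<integral>\<^sup>+w. avoid (l n / 2) x w * avoid (l n / 2) y w \<partial>\<mu>)
          \<le> ennreal (1 + \<kappa> * l n * of_bool (dist x y < l n))"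
        using nn_integral_avoid_avoid_le[of x "l n / 2" "c * l n" y "\<kappa> * l n"] n True l[of n] mass[of n]
        by simp
    qed
    also have "\<dots> = ennreal (\<Prod>n=n0..N. 1 + \<kappa> * l n * of_bool (dist x y < l n))"
      using \<kappa> l by (intro prod_ennreal) (auto intro!: add_nonneg_nonneg mult_nonneg_nonneg)
    also have "\<dots> \<le> ennreal (1 + (\<Sum>n=n0..N. \<kappa> * l n * (\<Prod>k=n0..<n. 1 + \<kappa> * l k) * of_bool (dist x y < l n)))"
      using \<kappa> l by (intro ennreal_leI prod_kernel_le) auto
    finally show ?thesis .
  qed (auto simp: Q_def)
  \<comment> \<open>Tonelli moves the expectation innermost. In the kernel bound the variable
    \<open>y\<close> enters only through the balls of radius \<open>l n\<close> around
    \<open>x\<close>, of measure at most \<open>2 * l n\<close>; this yields the square of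
    \<open>l n\<close> in the hypothesis on \<open>S\<close>.\<close>
  have EX2: "(\<integral>\<^sup>+a. X a * X a \<partial>M) \<le> ennreal (1 + S)"
  proof -
    have "X a * X a = (\<integral>\<^sup>+x. \<integral>\<^sup>+y. Q a x * Q a y \<partial>circle_lebesgue \<partial>circle_lebesgue)"
      if a [measurable]: "a \<in> space M" for a
    proof -
      have [measurable]: "Q a \<in> borel_measurable borel" by measurable
      show ?thesis
        unfolding X_def by (subst nn_integral_cmult, simp) (simp add: nn_integral_multc)
    qed
    then have "(\<integral>\<^sup>+a. X a * X a \<partial>M)
        = (\<integral>\<^sup>+a. \<integral>\<^sup>+x. \<integral>\<^sup>+y. Q a x * Q a y \<partial>circle_lebesgue \<partial>circle_lebesgue \<partial>M)"
      by (rule nn_integral_cong)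
    also have "\<dots> = (\<integral>\<^sup>+x. \<integral>\<^sup>+a. \<integral>\<^sup>+y. Q a x * Q a y \<partial>circle_lebesgue \<partial>M \<partial>circle_lebesgue)"
      by (rule prod.Fubini'[symmetric]) measurable
    also have "\<dots> = (\<integral>\<^sup>+x. \<integral>\<^sup>+y. \<integral>\<^sup>+a. Q a x * Q a y \<partial>M \<partial>circle_lebesgue \<partial>circle_lebesgue)"
      by (intro nn_integral_cong prod.Fubini'[symmetric]) measurable
    also have "\<dots> \<le> (\<integral>\<^sup>+x. ennreal (1 + S) \<partial>circle_lebesgue)"
    proof (rule nn_integral_mono)
      fix x
      define A where "A n = (\<Prod>k=n0..<n. 1 + \<kappa> * l k)" for n
      have A: "0 \<le> A n" for n
        unfolding A_def using \<kappa> l by (intro prod_nonneg) (auto intro!: add_nonneg_nonneg mult_nonneg_nonneg)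
      have "(\<integral>\<^sup>+y. \<integral>\<^sup>+a. Q a x * Q a y \<partial>M \<partial>circle_lebesgue)
          \<le> (\<integral>\<^sup>+y. ennreal (1 + (\<Sum>n=n0..N. \<kappa> * l n * A n * of_bool (dist x y < l n))) \<partial>circle_lebesgue)"
        unfolding A_def by (intro nn_integral_mono kernel)
      also have "\<dots> = (\<integral>\<^sup>+y. 1 + (\<Sum>n=n0..N. ennreal (\<kappa> * l n * A n) * indicator (ball x (l n)) y) \<partial>circle_lebesgue)"
      proof (rule nn_integral_cong)
        fix y
        have "ennreal (1 + (\<Sum>n=n0..N. \<kappa> * l n * A n * of_bool (dist x y < l n)))
          = 1 + ennreal (\<Sum>n=n0..N. \<kappa> * l n * A n * of_bool (dist x y < l n))"
          using \<kappa> l A by (subst ennreal_plus) (auto intro!: sum_nonneg mult_nonneg_nonneg)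
        also have "ennreal (\<Sum>n=n0..N. \<kappa> * l n * A n * of_bool (dist x y < l n))
          = (\<Sum>n=n0..N. ennreal (\<kappa> * l n * A n * of_bool (dist x y < l n)))"
          using \<kappa> l A by (intro sum_ennreal[symmetric] mult_nonneg_nonneg) auto
        also have "\<dots>
          = (\<Sum>n=n0..N. ennreal (\<kappa> * l n * A n) * indicator (ball x (l n)) y)"
          by (intro sum.cong) (auto simp: indicator_def)
        finally show "ennreal (1 + (\<Sum>n=n0..N. \<kappa> * l n * A n * of_bool (dist x y < l n)))
          = 1 + (\<Sum>n=n0..N. ennreal (\<kappa> * l n * A n) * indicator (ball x (l n)) y)" .
      qed
      also have "\<dots> = 1 + (\<Sum>n=n0..N. ennreal (\<kappa> * l n * A n) * emeasure circle_lebesgue (ball x (l n)))"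
      proof -
        have [measurable]: "ball x (l n) \<in> sets borel" for n by simp
        have "(\<integral>\<^sup>+y. ennreal (\<kappa> * l n * A n) * indicator (ball x (l n)) y \<partial>circle_lebesgue)
            = ennreal (\<kappa> * l n * A n) * emeasure circle_lebesgue (ball x (l n))" for n
          by (rule nn_integral_cmult_indicator) simp
        then show ?thesis
          by (subst nn_integral_add, measurable, subst nn_integral_sum, measurable)
            (simp only: nn_integral_const space_circle_lebesgue emeasure_circle_lebesgue_UNIV mult_1)
      qed
      also have "\<dots> \<le> 1 + (\<Sum>n=n0..N. ennreal (\<kappa> * l n * A n) * ennreal (2 * l n))"
        using l by (intro add_left_mono sum_mono mult_left_mono emeasure_circle_lebesgue_ball_le) auto
      also have "\<dots> = 1 + (\<Sum>n=n0..N. ennreal (2 * \<kappa> * (l n)\<^sup>2 * A n))"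
        using l \<kappa> A by (intro arg_cong2[of _ _ _ _ "(+)"] refl sum.cong)
          (auto simp: ennreal_mult[symmetric] power2_eq_square mult_ac)
      also have "\<dots> = ennreal (1 + (\<Sum>n=n0..N. 2 * \<kappa> * (l n)\<^sup>2 * A n))"
        using \<kappa> l A by (subst ennreal_plus) (auto intro!: sum_nonneg mult_nonneg_nonneg simp: sum_ennreal)
      also have "\<dots> \<le> ennreal (1 + S)"
        using S unfolding A_def by (intro ennreal_leI) simp
      finally show "(\<integral>\<^sup>+y. \<integral>\<^sup>+a. Q a x * Q a y \<partial>M \<partial>circle_lebesgue) \<le> ennreal (1 + S)" .
    qed
    also have "\<dots> = ennreal (1 + S)" by (simp add: emeasure_circle_lebesgue_UNIV)
    finally show ?thesis .
  qed
  define G where "G = {a \<in> space M. X a \<noteq> 0}"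
  have [measurable]: "G \<in> events" unfolding G_def by measurable
  \<comment> \<open>In place of Cauchy-Schwarz, \<open>(s * X a - 1)\<^sup>2 \<ge> 0\<close> bounds
    \<open>X a\<close> on \<open>G\<close> by \<open>s / 2 * (X a)\<^sup>2 + 1 / (2 * s)\<close>.
    This \<open>s\<close> optimises the resulting lower bound for \<open>prob G\<close>.\<close>
  define s where "s = e / (1 + S)"
  have s: "s > 0" using e S by (simp add: s_def)
  have "ennreal e \<le> ennreal (e / 2 + prob G / (2 * s))"
  proof -
    have "ennreal e = (\<integral>\<^sup>+a. X a \<partial>M)" by (simp add: EX)
    also have "\<dots> \<le> (\<integral>\<^sup>+a. ennreal (s / 2) * (X a * X a) + ennreal (1 / (2 * s)) * indicator G a \<partial>M)"
    proof (rule nn_integral_mono)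
      fix a assume a: "a \<in> space M"
      show "X a \<le> ennreal (s / 2) * (X a * X a) + ennreal (1 / (2 * s)) * indicator G a"
      proof (cases "X a")
        case top
        then show ?thesis using s by (simp add: ennreal_mult_top)
      next
        case (real r)
        show ?thesis
        proof (cases "r = 0")
          case False
          then have "a \<in> G" using a real by (simp add: G_def)
          have "0 \<le> (s * r - 1)\<^sup>2 / (2 * s)" using s by simp
          also have "\<dots> = s / 2 * (r * r) + 1 / (2 * s) - r"
            using s by (simp add: power2_eq_square field_simps)
          finally have "r \<le> s / 2 * (r * r) + 1 / (2 * s)" by simp
          then have "ennreal r \<le> ennreal (s / 2 * (r * r) + 1 / (2 * s))" by (rule ennreal_leI)
          also have "\<dots> = ennreal (s / 2) * (ennreal r * ennreal r) + ennreal (1 / (2 * s))"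
            using s real by (simp add: ennreal_mult[symmetric] ennreal_plus[symmetric] del: ennreal_plus)
          finally show ?thesis using real \<open>a \<in> G\<close> by simp
        qed (use real in simp)
      qed
    qed
    also have "\<dots> = ennreal (s / 2) * (\<integral>\<^sup>+a. X a * X a \<partial>M) + ennreal (1 / (2 * s)) * emeasure M G"
      by (simp add: nn_integral_add nn_integral_cmult nn_integral_cmult_indicator)
    also have "\<dots> \<le> ennreal (s / 2) * ennreal (1 + S) + ennreal (1 / (2 * s)) * emeasure M G"
      using EX2 by (intro add_right_mono mult_left_mono) auto
    also have "\<dots> = ennreal (s / 2 * (1 + S) + prob G / (2 * s))"
      using s S(2) by (simp add: emeasure_eq_measure ennreal_mult[symmetric] ennreal_plus[symmetric]
          del: ennreal_plus)
    also have "s / 2 * (1 + S) = e / 2"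
      using S(2) by (simp add: s_def divide_simps)
    finally show ?thesis .
  qed
  then have "e \<le> e / 2 + prob G / (2 * s)"
    using s e(2) by (subst (asm) ennreal_le_iff) auto
  then have "e * s \<le> prob G" using s by (simp add: field_simps)
  then have prob_G: "e\<^sup>2 / (1 + S) \<le> prob G" by (simp add: s_def power2_eq_square)
  show ?thesis
  proof (rule that[OF \<open>G \<in> events\<close> prob_G])
    fix a assume "a \<in> G"
    show "\<exists>x\<in>E. \<forall>n\<in>{n0..N}. x \<notin> ball (\<omega> n a) (l n / 2)"
    proof (rule ccontr)
      assume "\<not> ?thesis"
      then have "\<exists>n\<in>{n0..N}. avoid (l n / 2) x (\<omega> n a) = 0" if "x \<in> E" for x
        using that by (fastforce simp: avoid_def dist_commute)
      then have "Q a x = 0" for x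
        by (cases "x \<in> E") (auto simp: Q_def)
      then have "X a = 0" by (simp add: X_def)
      with \<open>a \<in> G\<close> show False by (simp add: G_def)
    qed
  qed
qed

text \<open>Under covering, compactness of \<open>E\<close> leaves finitely many arcs that already
  cover it, so almost every \<open>a\<close> is eventually outside \<open>G N\<close>. Dominated
  convergence then sends \<open>prob (G N)\<close> to 0. The \<open>G N\<close> need not be
  nested.\<close>

lemma not_covered_if_prob_uncovered_ge:
  assumes E: "closed E" and "e > 0"
    and G: "\<And>N. G N \<in> events" "\<And>N. e \<le> prob (G N)"
    "\<And>N a. a \<in> G N \<Longrightarrow> \<exists>x\<in>E. \<forall>n\<in>{n0..N}. x \<notin> ball (\<omega> n a) (l n / 2)"
  shows "\<not> dvoretzky_covered M \<omega> l"
proof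
  assume "dvoretzky_covered M \<omega> l"
  then have "AE a in M. \<forall>\<^sub>F N in sequentially. a \<notin> G N"
    unfolding dvoretzky_covered_def
  proof eventually_elim
    case (elim a)
    have "compact E"
      using closed_Int_compact[OF E compact_UNIV_circle] by simp
    moreover have "E \<subseteq> (\<Union>n\<in>{n0..}. ball (\<omega> n a) (l n / 2))"
      using elim mem_limsup_sets[of _ "\<lambda>n. arc_interval (\<omega> n a) (l n)"]
      unfolding arc_interval_eq_ball by blast
    ultimately obtain J where J: "J \<subseteq> {n0..}" "finite J" "E \<subseteq> (\<Union>n\<in>J. ball (\<omega> n a) (l n / 2))"
      using compactE_image[of E "{n0..}" "\<lambda>n. ball (\<omega> n a) (l n / 2)"] by (metis open_ball)
    show ?case
    proof (rule eventually_sequentiallyI)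
      \<comment> \<open>Inserting 0 keeps \<open>Max\<close> meaningful for empty
        \<open>J\<close>.\<close>
      fix N assume N: "Max (insert 0 J) \<le> N"
      have "J \<subseteq> {n0..N}" using J N by auto
      then have "E \<subseteq> (\<Union>n\<in>{n0..N}. ball (\<omega> n a) (l n / 2))" using J(3) by blast
      then show "a \<notin> G N" using G(3)[of a N] by blast
    qed
  qed
  then have "AE a in M. (\<lambda>N. indicator (G N) a :: real) \<longlonglongrightarrow> 0"
    by eventually_elim (auto intro!: tendsto_eventually elim!: eventually_mono)
  then have "(\<lambda>N. integral\<^sup>L M (indicator (G N))) \<longlonglongrightarrow> integral\<^sup>L M (\<lambda>_. 0 :: real)"
    using G(1) by (intro integral_dominated_convergence[where w = "\<lambda>_. 1"]) auto
  then have "(\<lambda>N. prob (G N)) \<longlonglongrightarrow> 0" using G(1) by simp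
  then have "e \<le> 0" using G(2) by (intro LIMSEQ_le_const) auto
  with \<open>e > 0\<close> show False by simp
qed

end

subsection \<open>The necessary condition\<close>

text \<open>Here \<open>B\<close> is extended real so that \<open>1 / 0 = \<infinity>\<close> is
  included. Taking the maximum with 0 before interpolating ensures \<open>L > 0\<close>.\<close>

lemma sum_le_of_log_average_limsup_less:
  assumes "\<And>n. n \<ge> 1 \<Longrightarrow> 0 < l n" and "log_average_limsup l < B" "B > 0"
  obtains L where "L > 0" "ereal L < B" "\<forall>\<^sub>F n in sequentially. (\<Sum>k=1..n. l k) \<le> L * ln (real n)"
proof -
  have "max 0 (log_average_limsup l) < B" using assms by simp
  from ereal_dense2[OF this] obtain L where L: "0 < L" "log_average_limsup l < ereal L" "ereal L < B"
    by (auto simp: zero_ereal_def)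
  have "\<forall>\<^sub>F n in sequentially. ereal ((\<Sum>k=1..n. l k) / ln (real n)) < ereal L"
    using L(2) unfolding log_average_limsup_def by (rule Limsup_lessD)
  then have "\<forall>\<^sub>F n in sequentially. (\<Sum>k=1..n. l k) \<le> L * ln (real n)"
    using eventually_ge_at_top[of 2]
    by eventually_elim (simp add: pos_divide_less_eq)
  with L show ?thesis by (intro that)
qed

text \<open>The last of the \<open>n\<close> summands is the smallest, so \<open>n\<close> copies of
  it do not exceed the sum.\<close>

lemma le_log_div_if_sum_le:
  fixes l :: "nat \<Rightarrow> real"
  assumes anti: "antimono_on {1..} l" and "n \<ge> 1" and "(\<Sum>k=1..n. l k) \<le> B"
  shows "l n \<le> B / real n"
proof -
  have "real n * l n = (\<Sum>k=1..n. l n)" using \<open>n \<ge> 1\<close> by simp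
  also have "\<dots> \<le> (\<Sum>k=1..n. l k)"
    using anti by (intro sum_mono) (auto simp: monotone_on_def)
  also note assms(3)
  finally show ?thesis using \<open>n \<ge> 1\<close> by (simp add: field_simps)
qed

lemma prod_one_plus_le_exp:
  fixes l :: "nat \<Rightarrow> real"
  assumes "\<kappa> \<ge> 0" "\<And>k. k \<ge> 1 \<Longrightarrow> 0 < l k" "n0 \<ge> 1"
  shows "(\<Prod>k=n0..<n. 1 + \<kappa> * l k) \<le> exp (\<kappa> * (\<Sum>k=1..n. l k))"
proof -
  have "(\<Prod>k=n0..<n. 1 + \<kappa> * l k) \<le> (\<Prod>k=n0..<n. exp (\<kappa> * l k))"
    using assms by (intro prod_mono)
      (auto intro!: add_nonneg_nonneg mult_nonneg_nonneg simp: less_imp_le exp_ge_add_one_self)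
  also have "\<dots> = exp (\<kappa> * (\<Sum>k=n0..<n. l k))"
    by (simp add: exp_sum sum_distrib_left)
  also have "(\<Sum>k=n0..<n. l k) \<le> (\<Sum>k=1..n. l k)"
    using assms by (intro sum_mono2) (auto simp: less_imp_le)
  then have "exp (\<kappa> * (\<Sum>k=n0..<n. l k)) \<le> exp (\<kappa> * (\<Sum>k=1..n. l k))"
    using assms by (simp add: mult_left_mono)
  finally show ?thesis .
qed

text \<open>The total power \<open>\<theta> - 2\<close> lies below -1; half of that gap,
  \<open>\<delta>\<close>, absorbs the squared logarithm.\<close>

lemma summable_ln_squared_powr:
  assumes "\<theta> < 1"
  shows "summable (\<lambda>n. (ln (real n) / real n)\<^sup>2 * real n powr \<theta>)"
proof -
  define \<delta> where "\<delta> = (1 - \<theta>) / 2"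
  have \<theta>: "\<theta> = 1 - 2 * \<delta>" "\<delta> > 0" using assms by (auto simp: \<delta>_def field_simps)
  show ?thesis
  proof (rule summable_comparison_test_bigo)
    show "summable (\<lambda>n. norm (real n powr (- 1 - \<delta>)))"
      using \<theta> by (simp add: summable_real_powr_iff)
    show "(\<lambda>n. (ln (real n) / real n)\<^sup>2 * real n powr \<theta>) \<in> O(\<lambda>n. real n powr (- 1 - \<delta>))"
      unfolding \<theta>(1) using \<theta>(2) by real_asymp
  qed
qed

lemma (in random_density_centers) log_average_limsup_ge_if_covered:
  assumes anti: "antimono_on {1..} l" and pos: "\<And>n. n \<ge> 1 \<Longrightarrow> 0 < l n"
    and covered: "dvoretzky_covered M \<omega> l"
  shows "log_average_limsup l \<ge> 1 / ereal (min_density f)"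
proof (rule ccontr)
  assume "\<not> ?thesis"
  then have less: "log_average_limsup l < 1 / ereal (min_density f)" by simp
  define m where "m = min_density f"
  have "m \<ge> 0" unfolding m_def using density by (rule min_density_nonneg)
  have "1 / ereal m > 0"
    using \<open>m \<ge> 0\<close> by (cases "m = 0") (auto simp: one_divide_ereal_zero one_ereal_def)
  then obtain L where "L > 0" and L: "ereal L < 1 / ereal m"
    and sum_le: "\<forall>\<^sub>F n in sequentially. (\<Sum>k=1..n. l k) \<le> L * ln (real n)"
    using sum_le_of_log_average_limsup_less[OF pos less] unfolding m_def by blast
  have "m < 1 / L"
    using L \<open>L > 0\<close> \<open>m \<ge> 0\<close> by (cases "m = 0") (auto simp: one_ereal_def field_simps)
  \<comment> \<open>In \<open>m < c < \<kappa> < 1 / L\<close>, \<open>c\<close> bounds the ball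
    masses on \<open>E\<close>, the gap up to \<open>\<kappa>\<close> absorbs the factor
    \<open>1 / (1 - c * l n)\<^sup>2\<close>, and \<open>\<kappa> < 1 / L\<close> makes the exponent
    \<open>\<theta>\<close> less than 1.\<close>
  from dense[OF this] obtain \<kappa> where \<kappa>: "m < \<kappa>" "\<kappa> < 1 / L" by blast
  from dense[OF \<kappa>(1)] obtain c where c: "m < c" "c < \<kappa>" by blast
  define \<theta> where "\<theta> = \<kappa> * L"
  have "\<theta> < 1" using \<kappa>(2) \<open>L > 0\<close> by (simp add: \<theta>_def field_simps)
  have "\<kappa> > 0" using \<kappa> \<open>m \<ge> 0\<close> by simp
  obtain E d where E: "closed E" "emeasure circle_lebesgue E > 0" and "d > 0"
    and E_mass: "\<And>x r. \<lbrakk>x \<in> E; 0 < r; r < d\<rbrakk> \<Longrightarrow> measure (density_measure f) (ball x r) \<le> 2 * c * r"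
    using exists_closed_small_density[OF density min_density_less_imp] c(1) unfolding m_def by blast
  have l_le: "\<forall>\<^sub>F n in sequentially. l n \<le> L * ln (real n) / real n"
    using sum_le eventually_ge_at_top[of 1]
    by eventually_elim (rule le_log_div_if_sum_le[OF anti])
  have l_lim: "l \<longlonglongrightarrow> 0"
  proof (rule tendsto_sandwich[OF _ l_le])
    show "\<forall>\<^sub>F n in sequentially. 0 \<le> l n"
      using pos by (intro eventually_sequentiallyI[of 1]) (simp add: less_imp_le)
    show "(\<lambda>n. L * ln (real n) / real n) \<longlonglongrightarrow> 0" by real_asymp
  qed auto
  have "(\<lambda>n. c * l n) \<longlonglongrightarrow> c * 0" by (intro tendsto_intros l_lim)
  then have ev1: "\<forall>\<^sub>F n in sequentially. c * l n < 1"
    by (rule order_tendstoD) simp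
  have "(\<lambda>n. c / (1 - c * l n)\<^sup>2) \<longlonglongrightarrow> c / (1 - c * 0)\<^sup>2"
    by (intro tendsto_intros l_lim) simp
  then have ev2: "\<forall>\<^sub>F n in sequentially. c / (1 - c * l n)\<^sup>2 < \<kappa>"
    by (rule order_tendstoD) (use c in simp)
  have ev3: "\<forall>\<^sub>F n in sequentially. l n < d"
    using l_lim by (rule order_tendstoD) fact
  have "\<forall>\<^sub>F n in sequentially. 1 \<le> n \<and> (\<Sum>k=1..n. l k) \<le> L * ln (real n) \<and>
      l n \<le> L * ln (real n) / real n \<and> c * l n < 1 \<and> c / (1 - c * l n)\<^sup>2 < \<kappa> \<and> l n < d"
    by (intro eventually_conj sum_le l_le ev1 ev2 ev3 eventually_ge_at_top)
  then obtain n0 where n0: "\<And>n. n \<ge> n0 \<Longrightarrow> 1 \<le> n \<and> (\<Sum>k=1..n. l k) \<le> L * ln (real n) \<and>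
      l n \<le> L * ln (real n) / real n \<and> c * l n < 1 \<and> c / (1 - c * l n)\<^sup>2 < \<kappa> \<and> l n < d"
    by (auto simp: eventually_sequentially)
  have "n0 \<ge> 1" using n0 by blast
  \<comment> \<open>A summable majorant, uniform in \<open>N\<close>: \<open>l n\<close> is at most
    \<open>L * ln n / n\<close>, and the product at most
    \<open>exp (\<kappa> * L * ln n) = n powr \<theta>\<close>.\<close>
  define t where "t n = 2 * \<kappa> * L\<^sup>2 * ((ln (real n) / real n)\<^sup>2 * real n powr \<theta>)" for n
  have t_nonneg: "0 \<le> t n" for n using \<open>\<kappa> > 0\<close> by (simp add: t_def)
  have "summable t"
    unfolding t_def by (intro summable_mult summable_ln_squared_powr \<open>\<theta> < 1\<close>)
  have term_le: "2 * \<kappa> * (l n)\<^sup>2 * (\<Prod>k=n0..<n. 1 + \<kappa> * l k) \<le> t n" if "n \<ge> n0" for n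
  proof -
    have "n \<ge> 1" using n0[OF that] by simp
    have "(\<Prod>k=n0..<n. 1 + \<kappa> * l k) \<le> exp (\<kappa> * (\<Sum>k=1..n. l k))"
      using pos \<open>\<kappa> > 0\<close> \<open>n0 \<ge> 1\<close> by (intro prod_one_plus_le_exp) auto
    also have "\<dots> \<le> exp (\<kappa> * (L * ln (real n)))"
      using n0[OF that] \<open>\<kappa> > 0\<close> by simp
    also have "\<dots> = real n powr \<theta>"
      using \<open>n \<ge> 1\<close> by (simp add: powr_def \<theta>_def)
    finally have A: "(\<Prod>k=n0..<n. 1 + \<kappa> * l k) \<le> real n powr \<theta>" .
    have "0 \<le> l n" using pos[OF \<open>n \<ge> 1\<close>] by simp
    then have "(l n)\<^sup>2 \<le> (L * ln (real n) / real n)\<^sup>2"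
      using n0[OF that] by (intro power_mono) auto
    then have "2 * \<kappa> * (l n)\<^sup>2 * (\<Prod>k=n0..<n. 1 + \<kappa> * l k)
        \<le> 2 * \<kappa> * (L * ln (real n) / real n)\<^sup>2 * real n powr \<theta>"
      using A \<open>\<kappa> > 0\<close> pos \<open>n0 \<ge> 1\<close>
      by (intro mult_mono) (auto intro!: prod_nonneg add_nonneg_nonneg mult_nonneg_nonneg simp: less_imp_le)
    also have "\<dots> = t n" by (simp add: t_def power_mult_distrib power_divide)
    finally show ?thesis .
  qed
  define S where "S = suminf t"
  have S: "(\<Sum>n=n0..N. 2 * \<kappa> * (l n)\<^sup>2 * (\<Prod>k=n0..<n. 1 + \<kappa> * l k)) \<le> S" for N
  proof -
    have "(\<Sum>n=n0..N. 2 * \<kappa> * (l n)\<^sup>2 * (\<Prod>k=n0..<n. 1 + \<kappa> * l k)) \<le> (\<Sum>n=n0..N. t n)"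
      using term_le by (intro sum_mono) auto
    also have "\<dots> \<le> S"
      unfolding S_def using \<open>summable t\<close> t_nonneg by (intro sum_le_suminf) auto
    finally show ?thesis .
  qed
  have "S \<ge> 0" unfolding S_def using \<open>summable t\<close> t_nonneg by (intro suminf_nonneg)
  interpret leb: prob_space circle_lebesgue by (rule prob_space_circle_lebesgue)
  define e where "e = measure circle_lebesgue E"
  have "e > 0" using E(2) by (simp add: e_def leb.emeasure_eq_measure)
  have l_props: "0 \<le> l n \<and> c * l n < 1 \<and> c / (1 - c * l n)\<^sup>2 \<le> \<kappa>" if "n \<ge> n0" for n
    using n0[OF that] pos[of n] by auto
  have mass: "measure (density_measure f) (ball x (l n / 2)) \<le> c * l n" if "n \<ge> n0" "x \<in> E" for n x
    using E_mass[OF that(2), of "l n / 2"] n0[OF that(1)] pos[of n] by simp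
  have "\<exists>G. G \<in> events \<and> e\<^sup>2 / (1 + S) \<le> prob G \<and>
      (\<forall>a\<in>G. \<exists>x\<in>E. \<forall>n\<in>{n0..N}. x \<notin> ball (\<omega> n a) (l n / 2))" for N
    by (rule prob_uncovered_ge[OF \<open>n0 \<ge> 1\<close> borel_closed[OF E(1)] less_imp_le[OF \<open>\<kappa> > 0\<close>]
          l_props mass S \<open>S \<ge> 0\<close> e_def \<open>e > 0\<close>]) auto
  then obtain G where G: "\<And>N. G N \<in> events" "\<And>N. e\<^sup>2 / (1 + S) \<le> prob (G N)"
    "\<And>N a. a \<in> G N \<Longrightarrow> \<exists>x\<in>E. \<forall>n\<in>{n0..N}. x \<notin> ball (\<omega> n a) (l n / 2)"
    by metis
  have "0 < e\<^sup>2 / (1 + S)" using \<open>e > 0\<close> \<open>S \<ge> 0\<close> by simp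
  from not_covered_if_prob_uncovered_ge[OF E(1) this G] covered show False by contradiction
qed

theorem theorem1p1:
  fixes f :: "circle \<Rightarrow> real"
    and l :: "nat \<Rightarrow> real"
    and M :: "'a measure"
    and \<omega> :: "nat \<Rightarrow> 'a \<Rightarrow> circle"
  assumes "prob_density f"
    and "antimono_on {1..} l"
    and "\<And>n. n \<ge> 1 \<Longrightarrow> 0 < l n \<and> l n < 1"
    and "prob_space M"
    and "prob_space.indep_vars M (\<lambda>_. borel) \<omega> {1..}"
    and "\<And>n. n \<ge> 1 \<Longrightarrow> distr M borel (\<omega> n) = density_measure f"
  shows "(dvoretzky_covered M \<omega> l \<longrightarrow> log_average_limsup l \<ge> 1 / ereal (min_density f)) \<and>
    (min_density f > 0 \<and> log_average_limsup l > 1 / ereal (min_density f)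
      \<longrightarrow> dvoretzky_covered M \<omega> l) \<and>
    (min_density f > 0 \<and> upper_box_dim (min_set f) < 1
      \<longrightarrow> (dvoretzky_covered M \<omega> l \<longleftrightarrow> log_average_limsup l \<ge> 1 / ereal (min_density f)))"
proof -
  interpret prob_space M by fact
  interpret random_density_centers M \<omega> f
    using assms by unfold_locales auto
  have pos: "\<And>n. n \<ge> 1 \<Longrightarrow> 0 < l n" using assms(3) by blast
  show ?thesis
    using log_average_limsup_ge_if_covered[OF assms(2) pos] covered_if_greater[OF _ _ assms(2) pos]
      covered_if_box_dim_less_1[OF _ _ _ assms(2) pos]
    by blast
qed

end
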